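(* Let $(\mathbb{T},\log,\partial,\circ,x)$, with $\mathbb{T}=\mathbf{R}[[\mathfrak{N}]]$, be a structure satisfying conditions (i)–(viii) of the context, where moreover $(\mathbf{R},+,\cdot,0,1,<,\exp)$ is a model of the first-order theory of the real ordered exponential field. Let $\mathfrak{M}\subseteq\mathfrak{N}$ be a subgroup containing $x$ such that $\mathbb{S}:=\mathbf{R}[[\mathfrak{M}]]$ is a differential subfield of $\mathbb{T}$ with $\partial(\mathbb{S})=\mathbb{S}$, $\mathbb{S}$ is closed under $\circ$, and $(\mathbb{S}^{>,\succ},\circ,x)$ is a group. Assume that $\mathbb{S}$ has a steep conjugate. Then for all $f\in\mathbb{S}^{>,\succ}$ with $f>x$, there is a $V\in\mathbb{S}^{>,\succ}$ with $V\circ f=V+1$.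
   Context: Well-based series. The set theory is NBG; groups and fields may be proper classes. For an ordered field $\mathbf{R}$ and a linearly ordered abelian group $(\mathfrak{N},\cdot,1,\prec)$, $\mathbf{R}[[\mathfrak{N}]]$ is the ordered field of functions $s:\mathfrak{N}\to\mathbf{R}$ whose support $\operatorname{supp}s$ is a set well-ordered for $\succ$, with pointwise sum and Cauchy product; $s>0$ iff $s\neq0$ and $s(\max\operatorname{supp}s)>0$. Monomials (elements of $\mathfrak{N}$) and elements of $\mathbf{R}$ are identified with series. For $s\neq0$, $\mathfrak{d}(s)=\max\operatorname{supp}s$. $s\prec t$ means $r|s|<|t|$ for all $r\in\mathbf{R}^{>}$; $s\preccurlyeq t$ means not $t\prec s$. For such a field $\mathbb{S}$: $\mathbb{S}_{\succ}=\{s:\operatorname{supp}s\succ1\}$, $\mathbb{S}^{\prec}=\{s:s\prec1\}$, $\mathbb{S}^{>,\succ}=\{s:s>\mathbf{R}\}$. A family $(s_i)$ is summable if $\bigcup_i\operatorname{supp}s_i$ is a set well-ordered by $\succ$ and each monomial lies in finitely many $\operatorname{supp}s_i$; an $\mathbf{R}$-linear map is strongly linear if it preserves summability and commutes with sums of summable families. When $\log$ is given, for $s,t\in\mathbb{T}^\times$: $s\prec\!\!\prec t$ iff $\log|s|\prec\log|t|$; $s\preccurlyeq\!\!\preccurlyeq t$ iff $\log|s|\preccurlyeq\log|t|$. Write $f'=\partial(f)$, $f^{(k)}=\partial^k(f)$. Conditions. (i) $\mathfrak{N}$ is a linearly ordered abelian group, $\mathbf{R}$ an ordered field, $\mathbb{T}=\mathbf{R}[[\mathfrak{N}]]$.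 (ii) $(\mathbb{T},\log)$ is an exponentially closed transserial field: $\log:(\mathbb{T}^{>},\cdot,1,<)\to(\mathbb{T},+,0,<)$ is an isomorphism of ordered groups, $\log\mathfrak{N}\subseteq\mathbb{T}_{\succ}$, $\log s\leqslant s-1$ for $s\in\mathbb{T}^{>}$, $\log(1+\varepsilon)=\sum_{k>0}\frac{(-1)^{k+1}}{k}\varepsilon^k$ for $\varepsilon\prec1$, and $\log$ restricts to an isomorphism $(\mathbf{R}^{>},\cdot,<)\to(\mathbf{R},+,<)$; $\exp$ on $\mathbf{R}$ is its inverse. (iii) $\partial:\mathbb{T}\to\mathbb{T}$ is a surjective transserial derivation (strongly linear, Leibniz rule, $\partial(\log|s|)=\partial(s)/s$ for $s\neq0$), with identity $x$ ($x>0$, $1\notin\operatorname{supp}x$, $\partial(x)=1$), which is flat: for $\mathfrak{m}\in\mathfrak{N}$ and $\mathfrak{n}\in\operatorname{supp}\partial(\mathfrak{m})$ there are $\mathfrak{f},\mathfrak{w}\in\mathfrak{N}$ with $\mathfrak{f}\prec\!\!\prec\mathfrak{m}$, $\mathfrak{w}\preccurlyeq\!\!\preccurlyeq x$, $\mathfrak{n}=\mathfrak{m}\mathfrak{f}\mathfrak{w}$. (iv) $(\mathbb{T},\partial)$ is an H-field: $\ker\partial=\mathbf{R}$ and $f'>0$ for $f\in\mathbb{T}^{>,\succ}$. (v) $\circ:\mathbb{T}\times\mathbb{T}^{>,\succ}\to\mathbb{T}$ is a transserial composition law (each $f\mapsto f\circ s$ is a strongly linear morphism of ordered rings commuting with $\log$,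 and $f\circ(s\circ t)=(f\circ s)\circ t$) with identity $x$ ($x\circ s=s$, $f\circ x=f$), which is flat: for $s\in\mathbb{T}^{>,\succ}$, $\mathfrak{m}\in\mathfrak{N}\setminus\{1\}$, $\mathfrak{n}\in\operatorname{supp}(\mathfrak{m}\circ s)$ there are $\mathfrak{f},\mathfrak{w}\in\mathfrak{N}$, $\mathfrak{u}\in\operatorname{supp}s$ with $\mathfrak{f}\prec\!\!\prec\mathfrak{m}$, $\mathfrak{w}\preccurlyeq1$, $\mathfrak{w}\preccurlyeq\!\!\preccurlyeq\mathfrak{u}$, $\mathfrak{n}=\mathfrak{d}(\mathfrak{m}\circ s)\mathfrak{f}\mathfrak{w}$. (vi) Chain rule $(f\circ s)'=s'(f'\circ s)$; and Taylor expansions: whenever $s\in\mathbb{T}^{>,\succ}$, $\delta\prec s$, and $(\mathfrak{m}'\circ s)\delta\prec\mathfrak{m}\circ s$ for all $\mathfrak{m}\in\operatorname{supp}f$, the family $((\mathfrak{m}^{(k)}\circ s)\delta^k)_{\mathfrak{m}\in\operatorname{supp}f,k\in\mathbb{N}}$ is summable, $f\circ(s+\delta)=\sum_k\frac{f^{(k)}\circ s}{k!}\delta^k=\sum_{\mathfrak{m},k}f(\mathfrak{m})\frac{\mathfrak{m}^{(k)}\circ s}{k!}\delta^k$, and $(f^{(k)}\circ s)\delta^k\succ(f^{(k+1)}\circ s)\delta^{k+1}$ whenever the left side is nonzero. (vii) $(\mathbb{T}^{>,\succ},\circ,x)$ is a group. (viii) Monotonicity: for $f\in\mathbb{T}\setminus\mathbf{R}$,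 the map $s\mapsto f\circ s$ on $\mathbb{T}^{>,\succ}$ is strictly increasing if $f'>0$ and strictly decreasing if $f'<0$. Steep conjugates. A steep subfield of $\mathbb{S}$ is a differential subfield $\mathbb{U}=\mathbf{R}[[\mathfrak{U}]]$ of $\mathbb{S}$, where $\mathfrak{U}\subseteq\mathfrak{M}$ is a subgroup containing $x$ such that $x\preccurlyeq\!\!\preccurlyeq\mathfrak{u}$ for all $\mathfrak{u}\in\mathfrak{U}\setminus\{1\}$. A steep conjugate of $\mathbb{S}$ is a steep subfield $\mathbb{U}$ such that for all $f\in\mathbb{S}^{>,\succ}$ with $f>x$ there are $V\in\mathbb{S}^{>,\succ}$ and $\varepsilon\in\mathbb{U}^{\prec}$ with $\varepsilon>0$ and $V\circ f=(x+\varepsilon)\circ V$. *)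

theory Defs
  imports Complex_Main "HOL-Library.Countable_Set" "HOL-Library.Groups_Big_Fun" "HOL-Algebra.Group"
begin

unbundle cardinal_syntax

section \<open>Sets among classes\<close>

text \<open>
  In NBG a class such as the group of monomials may be proper, while the support of a series
  has to be a set.  (This matters: a field of all well-based series over a nontrivial group that
  is a set carries no logarithm of the kind considered below.)  Here the subsets of a type play the
  role of classes, and the sets are the subsets of cardinality less than a fixed regular uncountable
  cardinal, given as the cardinality of a phantom type argument \<open>'k\<close>.  The NBG reading in a universe
  of rank an inaccessible cardinal is the special case where the cardinality of \<open>'k\<close> is that
  inaccessible.  If \<open>'k\<close> is large compared to the type of monomials, every class is a set.
\<close>

class regular_uncountable =
  assumes regular_UNIV: "regularCard |UNIV :: 'a set|"
    and uncountable_UNIV: "|UNIV :: nat set| <o |UNIV :: 'a set|"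

lemma infinite_UNIV_regular_uncountable: "infinite (UNIV :: 'k::regular_uncountable set)"
proof -
  have "|UNIV :: nat set| \<le>o |UNIV :: 'k set|"
    using uncountable_UNIV by (rule ordLess_imp_ordLeq)
  then show ?thesis
    using card_of_ordLeq_finite infinite_UNIV_nat by blast
qed

lemma finite_ordLess_regular_uncountable:
  "finite A \<Longrightarrow> |A| <o |UNIV :: 'k::regular_uncountable set|"
  by (rule finite_ordLess_infinite)
    (simp_all only: Field_card_of infinite_UNIV_regular_uncountable card_of_well_order_on not_False_eq_True)

lemma small_Times:
  assumes "|A| <o |UNIV :: 'k::regular_uncountable set|" "|B| <o |UNIV :: 'k set|"
  shows "|A \<times> B| <o |UNIV :: 'k set|"
proof (rule stable_elim)
  show "stable |UNIV :: 'k set|"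
    by (rule regularCard_stable)
      (simp_all only: Field_card_of infinite_UNIV_regular_uncountable regular_UNIV card_of_card_order_on not_False_eq_True)
qed (use assms in auto)


text \<open>The least instance: the type of countable ordinals.\<close>

typedef omega1 = "Field (cardSuc natLeq)"
proof -
  have "\<not> finite (Field (cardSuc natLeq))"
    using Cinfinite_cardSuc[OF natLeq_Cinfinite] by (simp add: cinfinite_def)
  then show ?thesis by (metis ex_in_conv finite.emptyI)
qed

instance omega1 :: regular_uncountable
proof
  have Card: "Card_order (cardSuc natLeq)" by (simp add: cardSuc_Card_order natLeq_Card_order)
  have "bij_betw Rep_omega1 UNIV (Field (cardSuc natLeq))"
    by (metis bij_betw_def inj_onI Rep_omega1_inject type_definition.Rep_range[OF type_definition_omega1])
  then have "|UNIV :: omega1 set| =o |Field (cardSuc natLeq)|"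
    using card_of_ordIso by blast
  then have "|UNIV :: omega1 set| =o cardSuc natLeq"
    using card_of_Field_ordIso[OF Card] ordIso_transitive by blast
  then have iso: "cardSuc natLeq =o |UNIV :: omega1 set|" by (rule ordIso_symmetric)
  show "regularCard |UNIV :: omega1 set|"
    using iso Cinfinite_cardSuc[OF natLeq_Cinfinite] regularCard_cardSuc[OF natLeq_Cinfinite]
    by (rule regularCard_ordIso)
  have "|UNIV :: nat set| =o natLeq" by (rule card_of_nat)
  then show "|UNIV :: nat set| <o |UNIV :: omega1 set|"
    using cardSuc_greater[OF natLeq_Card_order] iso
    by (meson ordIso_ordLess_trans ordLess_ordIso_trans)
qed

section \<open>Well-based series\<close>

text \<open>
  Groups of monomials are written additively: \<open>0\<close> is the monomial 1, \<open>m + n\<close> the product of two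
  monomials, and \<open>m < n\<close> stands for m \<open>\<prec>\<close> n.  A subset \<open>A\<close> is well-ordered for the reverse
  ordering iff \<open>wfp_on A (>)\<close>.
\<close>

lemma wfp_on_greater_iff:
  fixes A :: "'n::linorder set"
  shows "wfp_on A (>) \<longleftrightarrow> (\<forall>B\<subseteq>A. B \<noteq> {} \<longrightarrow> (\<exists>m\<in>B. \<forall>b\<in>B. b \<le> m))"
  unfolding wfp_on_iff_ex_minimal by (meson linorder_not_less)

lemma wfp_on_greater_Un:
  fixes A B :: "'n::linorder set"
  assumes A: "wfp_on A (>)" and B: "wfp_on B (>)"
  shows "wfp_on (A \<union> B) (>)"
  unfolding wfp_on_greater_iff
proof (intro allI impI)
  fix C assume C: "C \<subseteq> A \<union> B" "C \<noteq> {}"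
  show "\<exists>m\<in>C. \<forall>b\<in>C. b \<le> m"
  proof (cases "C \<inter> A = {} \<or> C \<inter> B = {}")
    case True
    then have "C \<subseteq> A \<or> C \<subseteq> B" using C by blast
    then show ?thesis using A B C unfolding wfp_on_greater_iff by blast
  next
    case False
    obtain a where a: "a \<in> C \<inter> A" "\<forall>c\<in>C \<inter> A. c \<le> a"
      using A False unfolding wfp_on_greater_iff by (meson inf_le2)
    obtain b where b: "b \<in> C \<inter> B" "\<forall>c\<in>C \<inter> B. c \<le> b"
      using B False unfolding wfp_on_greater_iff by (meson inf_le2)
    have "max a b \<in> C" using a b by (auto simp: max_def)
    moreover have "c \<le> max a b" if "c \<in> C" for c
      using that a b C(1) by (auto simp: le_max_iff_disj)
    ultimately show ?thesis by blast
  qed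
qed

lemma finite_if_wfp_on_both:
  fixes P :: "'n::linorder set"
  assumes gr: "wfp_on P (>)" and le: "wfp_on P (<)"
  shows "finite P"
proof -
  have ex_max: "\<exists>m\<in>B. \<forall>b\<in>B. b \<le> m" if "B \<subseteq> P" "B \<noteq> {}" for B
    using gr that unfolding wfp_on_greater_iff by blast
  have fin: "finite {p\<in>P. p < a}" if "a \<in> P" for a
  proof (rule wfp_on_induct[OF le that])
    fix a assume less: "\<And>b. b \<in> P \<Longrightarrow> b < a \<Longrightarrow> finite {p\<in>P. p < b}"
    show "finite {p\<in>P. p < a}"
    proof (cases "{p\<in>P. p < a} = {}")
      case False
      then obtain b where b: "b \<in> {p\<in>P. p < a}" "\<forall>c\<in>{p\<in>P. p < a}. c \<le> b"
        using ex_max[of "{p\<in>P. p < a}"] by blast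
      have "{p\<in>P. p < a} \<subseteq> insert b {p\<in>P. p < b}"
      proof
        fix c assume c: "c \<in> {p\<in>P. p < a}"
        then have "c \<le> b" using b(2) by blast
        then show "c \<in> insert b {p\<in>P. p < b}" using c by (simp add: order_le_less disj_commute)
      qed
      moreover have "finite {p\<in>P. p < b}" using less[of b] b(1) by simp
      ultimately show ?thesis by (rule finite_subset[OF _ finite.insertI])
    qed (simp only: finite.emptyI)
  qed
  show ?thesis
  proof (cases "P = {}")
    case False
    then obtain m where m: "m \<in> P" "\<forall>p\<in>P. p \<le> m"
      using ex_max[of P] by blast
    have "P \<subseteq> insert m {p\<in>P. p < m}"
    proof
      fix c assume c: "c \<in> P"
      then have "c \<le> m" using m(2) by blast
      then show "c \<in> insert m {p\<in>P. p < m}" using c by (simp add: order_le_less disj_commute)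
    qed
    then show ?thesis using fin[OF m(1)] by (rule finite_subset[OF _ finite.insertI])
  qed simp
qed

lemma finite_fibre:
  fixes A B :: "'n::linordered_ab_group_add set"
  assumes A: "wfp_on A (>)" and B: "wfp_on B (>)"
  shows "finite {a\<in>A. m - a \<in> B}"
proof (rule finite_if_wfp_on_both)
  show "wfp_on {a\<in>A. m - a \<in> B} (>)" using A by (rule wfp_on_subset) blast
  have "wfp_on ((\<lambda>a. m - a) ` {a\<in>A. m - a \<in> B}) (>)" using B by (rule wfp_on_subset) blast
  then show "wfp_on {a\<in>A. m - a \<in> B} (<)" unfolding wfp_on_image by simp
qed

lemma wfp_on_greater_sums:
  fixes A B :: "'n::linordered_ab_group_add set"
  assumes A: "wfp_on A (>)" and B: "wfp_on B (>)"
  shows "wfp_on {a + b |a b. a \<in> A \<and> b \<in> B} (>)"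
proof (rule ccontr)
  assume "\<not> ?thesis"
  then obtain C where C: "C \<subseteq> {a + b |a b. a \<in> A \<and> b \<in> B}" "C \<noteq> {}"
      and nomax: "\<forall>m\<in>C. \<exists>c\<in>C. m < c"
    unfolding wfp_on_greater_iff by (meson linorder_not_less)
  define f where "f = (\<lambda>m. SOME c. c \<in> C \<and> m < c)"
  have f: "f m \<in> C \<and> m < f m" if "m \<in> C" for m
    using someI_ex[of "\<lambda>c. c \<in> C \<and> m < c"] nomax that unfolding f_def by blast
  obtain c0 where c0: "c0 \<in> C" using C by blast
  define c where "c i = (f ^^ i) c0" for i
  have cC: "c i \<in> C" for i by (induction i) (simp_all add: c_def c0 f)
  have "c i < c (Suc i)" for i using f[OF cC[of i]] by (simp add: c_def)
  then have smono: "strict_mono c" by (simp add: strict_mono_Suc_iff)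
  have "\<exists>a b. a \<in> A \<and> b \<in> B \<and> c i = a + b" for i using subsetD[OF C(1) cC[of i]] by blast
  then obtain a b where ab: "a i \<in> A" "b i \<in> B" "c i = a i + b i" for i by metis
  have no_incr: False if s: "strict_mono s" and S: "range s \<subseteq> S" and "wfp_on S (>)"
    for s :: "nat \<Rightarrow> 'n" and S
  proof -
    have "\<exists>m\<in>range s. \<forall>b\<in>range s. b \<le> m"
      using S \<open>wfp_on S (>)\<close> unfolding wfp_on_greater_iff by blast
    then obtain k where "\<forall>i. s i \<le> s k" by blast
    then have "s (Suc k) \<le> s k" by blast
    moreover have "s k < s (Suc k)" using s by (simp add: strict_mono_less)
    ultimately show False by simp
  qed
  obtain g :: "nat \<Rightarrow> nat" where g: "strict_mono g" "monoseq (\<lambda>n. a (g n))"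
    using seq_monosub by blast
  have b_incr: False if dec: "\<forall>n\<ge>k. a (g n) \<le> a (g k)" "\<forall>i\<ge>k. \<forall>j\<ge>i. a (g j) \<le> a (g i)" for k
  proof (rule no_incr[OF _ _ B])
    show "strict_mono (\<lambda>n. b (g (n + k)))"
      unfolding strict_mono_Suc_iff
    proof
      fix n
      have le: "a (g (Suc n + k)) \<le> a (g (n + k))" using dec by simp
      have "c (g (n + k)) < c (g (Suc n + k))"
        using smono g(1) by (simp add: strict_mono_less)
      then have "a (g (n + k)) + b (g (n + k)) < a (g (Suc n + k)) + b (g (Suc n + k))"
        by (simp only: ab(3))
      also have "\<dots> \<le> a (g (n + k)) + b (g (Suc n + k))"
        using le by (rule add_right_mono)
      finally show "b (g (n + k)) < b (g (Suc n + k))" by simp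
    qed
    show "range (\<lambda>n. b (g (n + k))) \<subseteq> B" using ab by blast
  qed
  from g(2) consider (inc) "\<forall>m. \<forall>n\<ge>m. a (g m) \<le> a (g n)" | (dec) "\<forall>m. \<forall>n\<ge>m. a (g n) \<le> a (g m)"
    unfolding monoseq_def by blast
  then show False
  proof cases
    case inc
    have "range (\<lambda>n. a (g n)) \<subseteq> A" using ab by blast
    then have "\<exists>m\<in>range (\<lambda>n. a (g n)). \<forall>b\<in>range (\<lambda>n. a (g n)). b \<le> m"
      using A unfolding wfp_on_greater_iff by blast
    then obtain k where k: "\<forall>n. a (g n) \<le> a (g k)" by blast
    have "a (g n) = a (g k)" if "n \<ge> k" for n
      using k inc that by (blast intro: order_antisym)
    then have "\<forall>i\<ge>k. \<forall>j\<ge>i. a (g j) \<le> a (g i)"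
      by (metis order.trans order_refl)
    with k have "\<forall>n\<ge>k. a (g n) \<le> a (g k)" "\<forall>i\<ge>k. \<forall>j\<ge>i. a (g j) \<le> a (g i)"
      by blast+
    then show False by (rule b_incr)
  next
    case dec
    then show False by (intro b_incr[of 0]) blast+
  qed
qed

typedef (overloaded) ('r, 'n, 'k) hahn =
  "{f :: 'n::linordered_ab_group_add \<Rightarrow> 'r::linordered_field.
     wfp_on {m. f m \<noteq> 0} (>) \<and> |{m. f m \<noteq> 0}| <o |UNIV :: 'k::regular_uncountable set|}"
  morphisms coeff Abs_hahn
  by (rule exI[of _ "\<lambda>_. 0"]) (simp add: wfp_on_def finite_ordLess_regular_uncountable)

setup_lifting type_definition_hahn

definition supp :: "('r::linordered_field, 'n::linordered_ab_group_add, 'k::regular_uncountable) hahn \<Rightarrow> 'n set"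
  where "supp s = {m. coeff s m \<noteq> 0}"

lemma wfp_on_supp: "wfp_on (supp s) (>)"
  using coeff[of s] by (simp add: supp_def)

lemma small_supp:
  "|supp (s :: ('r::linordered_field, 'n::linordered_ab_group_add, 'k::regular_uncountable) hahn)|
     <o |UNIV :: 'k set|"
  using coeff[of s] by (simp add: supp_def)

lemma hahn_eqI: "(\<And>m. coeff s m = coeff t m) \<Longrightarrow> s = t"
  by (simp add: coeff_inject[symmetric] fun_eq_iff)

text \<open>The series with the single term \<open>c\<close> at the monomial \<open>m\<close>; in particular \<open>const c\<close> is \<open>c\<close>
  and \<open>mon m\<close> is \<open>m\<close>, viewed as series.\<close>

lift_definition single :: "'n::linordered_ab_group_add \<Rightarrow> 'r::linordered_field
    \<Rightarrow> ('r, 'n, 'k::regular_uncountable) hahn"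
  is "\<lambda>m c n. if n = m then c else 0"
proof -
  fix m :: 'n and c :: 'r
  show "wfp_on {n. (if n = m then c else 0) \<noteq> 0} (>) \<and>
      |{n. (if n = m then c else 0) \<noteq> 0}| <o |UNIV :: 'k set|"
  proof
    have sub: "{n. (if n = m then c else 0) \<noteq> 0} \<subseteq> {m}" by auto
    have "wfp_on {m} (>)" by (simp add: wfp_on_def)
    then show "wfp_on {n. (if n = m then c else 0) \<noteq> 0} (>)" using sub by (rule wfp_on_subset)
    show "|{n. (if n = m then c else 0) \<noteq> 0}| <o |UNIV :: 'k set|"
      by (rule finite_ordLess_regular_uncountable, rule finite_subset[OF sub]) simp
  qed
qed

abbreviation const :: "'r::linordered_field
    \<Rightarrow> ('r, 'n::linordered_ab_group_add, 'k::regular_uncountable) hahn"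
  where "const c \<equiv> single 0 c"

definition mon :: "'n::linordered_ab_group_add
    \<Rightarrow> ('r::linordered_field, 'n, 'k::regular_uncountable) hahn"
  where "mon m = single m 1"

lemma hahn_closed:
  fixes f :: "'n::linordered_ab_group_add \<Rightarrow> 'r::linordered_field"
  assumes "{m. f m \<noteq> 0} \<subseteq> A" "wfp_on A (>)" "|A| <o |UNIV :: 'k::regular_uncountable set|"
  shows "wfp_on {m. f m \<noteq> 0} (>) \<and> |{m. f m \<noteq> 0}| <o |UNIV :: 'k set|"
  using wfp_on_subset[OF assms(2,1)] ordLeq_ordLess_trans[OF card_of_mono1[OF assms(1)] assms(3)]
  by (rule conjI)

lemma small_Un:
  "|A| <o |UNIV :: 'k::regular_uncountable set| \<Longrightarrow> |B| <o |UNIV :: 'k set|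
     \<Longrightarrow> |A \<union> B| <o |UNIV :: 'k set|"
  by (rule card_of_Un_ordLess_infinite[OF infinite_UNIV_regular_uncountable])

lemma small_sums:
  fixes A B :: "'n::plus set"
  assumes "|A| <o |UNIV :: 'k::regular_uncountable set|" "|B| <o |UNIV :: 'k set|"
  shows "|{a + b |a b. a \<in> A \<and> b \<in> B}| <o |UNIV :: 'k set|"
proof -
  have eq: "{a + b |a b. a \<in> A \<and> b \<in> B} = (\<lambda>(a, b). a + b) ` (A \<times> B)" by auto
  show ?thesis
    unfolding eq by (rule ordLeq_ordLess_trans[OF card_of_image small_Times[OF assms]])
qed

instantiation hahn :: (linordered_field, linordered_ab_group_add, regular_uncountable) comm_ring_1
begin

lift_definition zero_hahn :: "('a, 'b, 'c) hahn" is "\<lambda>_. 0"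
  by (simp add: wfp_on_def finite_ordLess_regular_uncountable)

definition one_hahn :: "('a, 'b, 'c) hahn" where "1 = single 0 1"

lift_definition plus_hahn :: "('a, 'b, 'c) hahn \<Rightarrow> ('a, 'b, 'c) hahn \<Rightarrow> ('a, 'b, 'c) hahn"
  is "\<lambda>f g m. f m + g m"
proof -
  fix f g :: "'b \<Rightarrow> 'a"
  assume f: "wfp_on {m. f m \<noteq> 0} (>) \<and> |{m. f m \<noteq> 0}| <o |UNIV :: 'c set|"
    and g: "wfp_on {m. g m \<noteq> 0} (>) \<and> |{m. g m \<noteq> 0}| <o |UNIV :: 'c set|"
  show "wfp_on {m. f m + g m \<noteq> 0} (>) \<and> |{m. f m + g m \<noteq> 0}| <o |UNIV :: 'c set|"
    by (rule hahn_closed[of _ "{m. f m \<noteq> 0} \<union> {m. g m \<noteq> 0}"])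
      (use f g in \<open>auto intro: wfp_on_greater_Un small_Un\<close>)
qed

lift_definition uminus_hahn :: "('a, 'b, 'c) hahn \<Rightarrow> ('a, 'b, 'c) hahn" is "\<lambda>f m. - f m"
  by simp

definition minus_hahn :: "('a, 'b, 'c) hahn \<Rightarrow> ('a, 'b, 'c) hahn \<Rightarrow> ('a, 'b, 'c) hahn"
  where "s - t = s + - t" for s t :: "('a, 'b, 'c) hahn"

lift_definition times_hahn :: "('a, 'b, 'c) hahn \<Rightarrow> ('a, 'b, 'c) hahn \<Rightarrow> ('a, 'b, 'c) hahn"
  is "\<lambda>f g m. Sum_any (\<lambda>a. f a * g (m - a))"
proof -
  fix f g :: "'b \<Rightarrow> 'a"
  assume f: "wfp_on {m. f m \<noteq> 0} (>) \<and> |{m. f m \<noteq> 0}| <o |UNIV :: 'c set|"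
    and g: "wfp_on {m. g m \<noteq> 0} (>) \<and> |{m. g m \<noteq> 0}| <o |UNIV :: 'c set|"
  let ?h = "\<lambda>m. Sum_any (\<lambda>a. f a * g (m - a))"
  have sub: "{m. ?h m \<noteq> 0} \<subseteq> {a + b |a b. a \<in> {m. f m \<noteq> 0} \<and> b \<in> {m. g m \<noteq> 0}}"
  proof
    fix m assume "m \<in> {m. ?h m \<noteq> 0}"
    then obtain a where "f a * g (m - a) \<noteq> 0"
      by (auto elim: Sum_any.not_neutral_obtains_not_neutral)
    then have "m = a + (m - a) \<and> f a \<noteq> 0 \<and> g (m - a) \<noteq> 0" by simp
    then show "m \<in> {a + b |a b. a \<in> {m. f m \<noteq> 0} \<and> b \<in> {m. g m \<noteq> 0}}" by blast
  qed
  show "wfp_on {m. ?h m \<noteq> 0} (>) \<and> |{m. ?h m \<noteq> 0}| <o |UNIV :: 'c set|"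
    using f g by (intro hahn_closed[OF sub] wfp_on_greater_sums small_sums) auto
qed

lemma finite_times_terms: "finite {a. coeff s a * coeff t (m - a) \<noteq> 0}"
  for s t :: "('a, 'b, 'c) hahn"
proof -
  have "{a. coeff s a * coeff t (m - a) \<noteq> 0} = {a\<in>supp s. m - a \<in> supp t}"
    by (auto simp: supp_def)
  then show ?thesis using finite_fibre[OF wfp_on_supp wfp_on_supp] by metis
qed

lemma coeff_single_times: "coeff (single n c * t) m = c * coeff t (m - n)"
  for t :: "('a, 'b, 'c) hahn"
proof -
  have "coeff (single n c * t) m = Sum_any (\<lambda>a. (if a = n then c else 0) * coeff t (m - a))"
    by (simp add: times_hahn.rep_eq single.rep_eq)
  also have "\<dots> = (\<Sum>a\<in>{n}. (if a = n then c else 0) * coeff t (m - a))"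
    by (rule Sum_any.expand_superset) (auto split: if_splits)
  finally show ?thesis by simp
qed

lemma times_hahn_comm: "s * t = t * s" for s t :: "('a, 'b, 'c) hahn"
proof (rule hahn_eqI)
  fix m
  have "Sum_any (\<lambda>a. coeff s a * coeff t (m - a)) = Sum_any (\<lambda>a. coeff t a * coeff s (m - a))"
  proof (rule Sum_any.reindex_cong)
    show "bij (\<lambda>a. m - a)"
      by (rule o_bij[of "\<lambda>a. m - a"]) (auto simp: fun_eq_iff)
    show "(\<lambda>a. coeff s a * coeff t (m - a)) \<circ> (\<lambda>a. m - a) = (\<lambda>a. coeff t a * coeff s (m - a))"
      by (auto simp: fun_eq_iff mult.commute)
  qed
  then show "coeff (s * t) m = coeff (t * s) m" by (simp add: times_hahn.rep_eq)
qed

lemma times_hahn_add: "(s + t) * u = s * u + t * u" for s t u :: "('a, 'b, 'c) hahn"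
proof (rule hahn_eqI)
  fix m
  show "coeff ((s + t) * u) m = coeff (s * u + t * u) m"
    by (simp add: times_hahn.rep_eq plus_hahn.rep_eq distrib_right
        Sum_any.distrib[OF finite_times_terms finite_times_terms])
qed

lemma times_hahn_assoc: "(s * t) * u = s * (t * u)" for s t u :: "('a, 'b, 'c) hahn"
proof (rule hahn_eqI)
  fix m
  define AB where "AB = {a + b |a b. a \<in> supp s \<and> b \<in> supp t}"
  define Z where "Z = {z\<in>AB. m - z \<in> supp u}"
  have finZ: "finite Z"
    unfolding Z_def AB_def by (intro finite_fibre wfp_on_greater_sums wfp_on_supp)
  define X where "X = (\<Union>z\<in>Z. {a\<in>supp s. z - a \<in> supp t})"
  have finX: "finite X"
    unfolding X_def using finZ finite_fibre[OF wfp_on_supp wfp_on_supp] by blast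
  have st: "coeff (s * t) z = (\<Sum>a\<in>X. coeff s a * coeff t (z - a))" if "z \<in> Z" for z
    unfolding times_hahn.rep_eq
    by (rule Sum_any.expand_superset[OF finX]) (use that in \<open>auto simp: X_def supp_def\<close>)
  have "coeff ((s * t) * u) m = (\<Sum>z\<in>Z. coeff (s * t) z * coeff u (m - z))"
    unfolding times_hahn.rep_eq[of "s * t"]
  proof (rule Sum_any.expand_superset[OF finZ], safe)
    fix z assume nz: "coeff (s * t) z * coeff u (m - z) \<noteq> 0"
    then have "Sum_any (\<lambda>a. coeff s a * coeff t (z - a)) \<noteq> 0" by (simp add: times_hahn.rep_eq)
    then obtain a where "coeff s a * coeff t (z - a) \<noteq> 0"
      by (rule Sum_any.not_neutral_obtains_not_neutral)
    then have "z = a + (z - a) \<and> a \<in> supp s \<and> z - a \<in> supp t" by (simp add: supp_def)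
    then have "z \<in> AB" unfolding AB_def by blast
    then show "z \<in> Z" using nz by (simp add: Z_def supp_def)
  qed
  also have "\<dots> = (\<Sum>z\<in>Z. \<Sum>a\<in>X. coeff s a * (coeff t (z - a) * coeff u (m - z)))"
    by (simp add: st sum_distrib_right mult.assoc)
  also have "\<dots> = (\<Sum>a\<in>X. coeff s a * (\<Sum>z\<in>Z. coeff t (z - a) * coeff u (m - z)))"
    by (subst sum.swap) (simp add: sum_distrib_left)
  also have "\<dots> = (\<Sum>a\<in>X. coeff s a * coeff (t * u) (m - a))"
  proof (rule sum.cong[OF refl])
    fix a assume "a \<in> X"
    then have a: "a \<in> supp s" by (auto simp: X_def)
    have "coeff (t * u) (m - a) = Sum_any (\<lambda>z. coeff t (z - a) * coeff u (m - z))"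
      unfolding times_hahn.rep_eq
    proof (rule Sum_any.reindex_cong)
      show "bij (\<lambda>z. z - a)"
        by (rule o_bij[of "\<lambda>z. z + a"]) (auto simp: fun_eq_iff)
      show "(\<lambda>z. coeff t z * coeff u (m - a - z)) \<circ> (\<lambda>z. z - a) =
          (\<lambda>z. coeff t (z - a) * coeff u (m - z))"
        by (auto simp: fun_eq_iff)
    qed
    also have "\<dots> = (\<Sum>z\<in>Z. coeff t (z - a) * coeff u (m - z))"
    proof (rule Sum_any.expand_superset[OF finZ], safe)
      fix z assume nz: "coeff t (z - a) * coeff u (m - z) \<noteq> 0"
      then have "z = a + (z - a) \<and> z - a \<in> supp t" by (simp add: supp_def)
      then have "z \<in> AB" unfolding AB_def using a by blast
      then show "z \<in> Z" using nz by (simp add: Z_def supp_def)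
    qed
    finally show "coeff s a * (\<Sum>z\<in>Z. coeff t (z - a) * coeff u (m - z)) =
        coeff s a * coeff (t * u) (m - a)" by simp
  qed
  also have "\<dots> = coeff (s * (t * u)) m"
    unfolding times_hahn.rep_eq[of s]
  proof (rule Sum_any.expand_superset[OF finX, symmetric], safe)
    fix a assume nz: "coeff s a * coeff (t * u) (m - a) \<noteq> 0"
    then have "Sum_any (\<lambda>b. coeff t b * coeff u (m - a - b)) \<noteq> 0" by (simp add: times_hahn.rep_eq)
    then obtain b where b: "coeff t b * coeff u (m - a - b) \<noteq> 0"
      by (rule Sum_any.not_neutral_obtains_not_neutral)
    have "a + b \<in> AB" unfolding AB_def using nz b by (auto simp: supp_def)
    then have "a + b \<in> Z" using b by (simp add: Z_def supp_def diff_diff_add)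
    moreover have "a \<in> supp s \<and> a + b - a \<in> supp t" using nz b by (simp add: supp_def)
    ultimately show "a \<in> X" unfolding X_def by blast
  qed
  finally show "coeff ((s * t) * u) m = coeff (s * (t * u)) m" .
qed

instance
proof
  fix s t u :: "('a, 'b, 'c) hahn"
  show "s * t * u = s * (t * u)" by (rule times_hahn_assoc)
  show "s * t = t * s" by (rule times_hahn_comm)
  show "1 * s = s" by (rule hahn_eqI) (simp add: one_hahn_def coeff_single_times)
  show "(s + t) * u = s * u + t * u" by (rule times_hahn_add)
  show "s + t + u = s + (t + u)" by (rule hahn_eqI) (simp add: plus_hahn.rep_eq add.assoc)
  show "s + t = t + s" by (rule hahn_eqI) (simp add: plus_hahn.rep_eq add.commute)
  show "0 + s = s" by (rule hahn_eqI) (simp add: plus_hahn.rep_eq zero_hahn.rep_eq)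
  show "- s + s = 0"
    by (rule hahn_eqI) (simp add: plus_hahn.rep_eq uminus_hahn.rep_eq zero_hahn.rep_eq)
  show "s - t = s + - t" by (rule minus_hahn_def)
  show "(0 :: ('a, 'b, 'c) hahn) \<noteq> 1"
  proof
    assume "(0 :: ('a, 'b, 'c) hahn) = 1"
    then have "coeff (0 :: ('a, 'b, 'c) hahn) 0 = coeff 1 0" by simp
    then show False by (simp add: zero_hahn.rep_eq one_hahn_def single.rep_eq)
  qed
qed

end

text \<open>The dominant monomial of \<open>s \<noteq> 0\<close>.\<close>

definition dommon :: "('r::linordered_field, 'n::linordered_ab_group_add, 'k::regular_uncountable) hahn \<Rightarrow> 'n"
  where "dommon s = (GREATEST m. m \<in> supp s)"

definition hpos :: "('r::linordered_field, 'n::linordered_ab_group_add, 'k::regular_uncountable) hahn \<Rightarrow> bool"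
  where "hpos s \<longleftrightarrow> s \<noteq> 0 \<and> 0 < coeff s (dommon s)"

lemma supp_empty_iff: "supp s = {} \<longleftrightarrow> s = 0"
  by (auto simp: supp_def zero_hahn.rep_eq intro: hahn_eqI)

lemma dommon_eqI:
  assumes "coeff s m \<noteq> 0" "\<And>n. m < n \<Longrightarrow> coeff s n = 0"
  shows "dommon s = m"
  unfolding dommon_def
  by (rule Greatest_equality) (use assms in \<open>auto simp: supp_def not_less[symmetric]\<close>)

lemma dommon:
  assumes "s \<noteq> 0"
  shows "coeff s (dommon s) \<noteq> 0" and "dommon s < n \<Longrightarrow> coeff s n = 0"
proof -
  obtain m where m: "m \<in> supp s" "\<forall>n\<in>supp s. n \<le> m"
    using assms wfp_on_supp[of s] supp_empty_iff[of s] unfolding wfp_on_greater_iff by blast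
  have top: "coeff s n = 0" if "m < n" for n using m that by (force simp: supp_def)
  have "dommon s = m" by (rule dommon_eqI) (use m top in \<open>auto simp: supp_def\<close>)
  then show "coeff s (dommon s) \<noteq> 0" and "dommon s < n \<Longrightarrow> coeff s n = 0"
    using m top by (auto simp: supp_def)
qed

lemma hpos_iff: "hpos s \<longleftrightarrow> (\<exists>m. 0 < coeff s m \<and> (\<forall>n>m. coeff s n = 0))"
proof
  assume "hpos s"
  then show "\<exists>m. 0 < coeff s m \<and> (\<forall>n>m. coeff s n = 0)"
    using dommon[of s] unfolding hpos_def by blast
next
  assume "\<exists>m. 0 < coeff s m \<and> (\<forall>n>m. coeff s n = 0)"
  then obtain m where m: "0 < coeff s m" "\<forall>n>m. coeff s n = 0" by blast
  then have "dommon s = m" by (intro dommon_eqI) auto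
  then show "hpos s" using m unfolding hpos_def by (auto simp: zero_hahn.rep_eq)
qed

lemma hpos_add:
  assumes "hpos s" "hpos t"
  shows "hpos (s + t)"
proof -
  obtain m where m: "0 < coeff s m" "\<forall>k>m. coeff s k = 0" using assms hpos_iff by blast
  obtain n where n: "0 < coeff t n" "\<forall>k>n. coeff t k = 0" using assms hpos_iff by blast
  have "0 < coeff (s + t) (max m n)"
    using m n by (cases m n rule: linorder_cases) (auto simp: plus_hahn.rep_eq max_def)
  moreover have "\<forall>k>max m n. coeff (s + t) k = 0" using m n by (simp add: plus_hahn.rep_eq)
  ultimately show ?thesis unfolding hpos_iff by blast
qed

lemma hpos_mult:
  assumes "hpos s" "hpos t"
  shows "hpos (s * t)"
proof -
  obtain m where m: "0 < coeff s m" "\<forall>k>m. coeff s k = 0" using assms hpos_iff by blast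
  obtain n where n: "0 < coeff t n" "\<forall>k>n. coeff t k = 0" using assms hpos_iff by blast
  have zero: "coeff s a * coeff t (k - a) = 0" if "m + n < k \<or> (m + n = k \<and> a \<noteq> m)" for k a
  proof (cases "m < a")
    case False
    then have "a \<le> m" by simp
    have "n < k - a"
    proof (cases "m + n < k")
      case True
      have "n + a \<le> m + n" using \<open>a \<le> m\<close> by (simp add: add.commute)
      then have "n + a < k" using True by (rule order_le_less_trans)
      then show ?thesis by (simp add: less_diff_eq)
    next
      case False
      then have "a < m" "k = m + n" using that \<open>a \<le> m\<close> by auto
      then show ?thesis by (simp add: less_diff_eq add.commute)
    qed
    then show ?thesis using n by simp
  qed (use m in simp)
  have "coeff (s * t) (m + n) = (\<Sum>a\<in>{m}. coeff s a * coeff t (m + n - a))"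
    unfolding times_hahn.rep_eq by (rule Sum_any.expand_superset) (use zero in auto)
  then have "0 < coeff (s * t) (m + n)" using m n by simp
  moreover have "coeff (s * t) k = 0" if "m + n < k" for k
  proof -
    have "(\<lambda>a. coeff s a * coeff t (k - a)) = (\<lambda>a. 0)"
      by (rule ext, rule zero) (simp add: that)
    then show ?thesis by (simp only: times_hahn.rep_eq Sum_any.neutral)
  qed
  ultimately show ?thesis unfolding hpos_iff by blast
qed

lemma hpos_total: "s = 0 \<or> hpos s \<or> hpos (- s)"
proof (cases "s = 0")
  case False
  show ?thesis
  proof (cases "0 < coeff s (dommon s)")
    case True
    then show ?thesis using False by (simp add: hpos_def)
  next
    case neg: False
    then have "0 < coeff (- s) (dommon s)" using dommon(1)[OF False] by (simp add: uminus_hahn.rep_eq)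
    moreover have "\<forall>n>dommon s. coeff (- s) n = 0"
      using dommon(2)[OF False] by (simp add: uminus_hahn.rep_eq)
    ultimately show ?thesis unfolding hpos_iff[of "- s"] by blast
  qed
qed simp

lemma not_hpos_zero: "\<not> hpos 0" by (simp add: hpos_def)

instantiation hahn :: (linordered_field, linordered_ab_group_add, regular_uncountable) linordered_idom
begin

definition less_hahn :: "('a, 'b, 'c) hahn \<Rightarrow> ('a, 'b, 'c) hahn \<Rightarrow> bool"
  where "s < t \<longleftrightarrow> hpos (t - s)" for s t :: "('a, 'b, 'c) hahn"

definition less_eq_hahn :: "('a, 'b, 'c) hahn \<Rightarrow> ('a, 'b, 'c) hahn \<Rightarrow> bool"
  where "s \<le> t \<longleftrightarrow> s = t \<or> s < t" for s t :: "('a, 'b, 'c) hahn"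

definition abs_hahn :: "('a, 'b, 'c) hahn \<Rightarrow> ('a, 'b, 'c) hahn"
  where "\<bar>s\<bar> = (if s < 0 then - s else s)" for s :: "('a, 'b, 'c) hahn"

definition sgn_hahn :: "('a, 'b, 'c) hahn \<Rightarrow> ('a, 'b, 'c) hahn"
  where "sgn s = (if s = 0 then 0 else if 0 < s then 1 else - 1)" for s :: "('a, 'b, 'c) hahn"

instance
proof
  fix s t u :: "('a, 'b, 'c) hahn"
  have asym: "\<not> (s < t \<and> t < s)" for s t :: "('a, 'b, 'c) hahn"
    using hpos_add[of "t - s" "s - t"] not_hpos_zero by (auto simp: less_hahn_def)
  have trans: "s < t \<Longrightarrow> t < u \<Longrightarrow> s < u" for s t u :: "('a, 'b, 'c) hahn"
    using hpos_add[of "t - s" "u - t"] by (simp add: less_hahn_def)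
  show "(s < t) = (s \<le> t \<and> \<not> t \<le> s)"
    using asym[of s t] asym[of t t] unfolding less_eq_hahn_def by auto
  show "s \<le> s" by (simp add: less_eq_hahn_def)
  show "s \<le> t \<Longrightarrow> t \<le> u \<Longrightarrow> s \<le> u" using trans unfolding less_eq_hahn_def by blast
  show "s \<le> t \<Longrightarrow> t \<le> s \<Longrightarrow> s = t" using asym unfolding less_eq_hahn_def by blast
  show "s \<le> t \<or> t \<le> s"
    using hpos_total[of "t - s"] unfolding less_eq_hahn_def less_hahn_def by auto
  show "s \<le> t \<Longrightarrow> u + s \<le> u + t" unfolding less_eq_hahn_def less_hahn_def by auto
  show "s < t \<Longrightarrow> 0 < u \<Longrightarrow> u * s < u * t"
    using hpos_mult[of u "t - s"] unfolding less_hahn_def by (simp add: right_diff_distrib)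
  show "\<bar>s\<bar> = (if s < 0 then - s else s)" by (rule abs_hahn_def)
  show "sgn s = (if s = 0 then 0 else if 0 < s then 1 else - 1)" by (rule sgn_hahn_def)
qed

end
section \<open>Asymptotic relations and subclasses of series\<close>

definition dominated :: "('r::linordered_field, 'n::linordered_ab_group_add, 'k::regular_uncountable) hahn
    \<Rightarrow> ('r, 'n, 'k) hahn \<Rightarrow> bool"  (infix "\<prec>" 50)
  where "s \<prec> t \<longleftrightarrow> (\<forall>r>0. const r * \<bar>s\<bar> < \<bar>t\<bar>)"

definition dominated_eq :: "('r::linordered_field, 'n::linordered_ab_group_add, 'k::regular_uncountable) hahn
    \<Rightarrow> ('r, 'n, 'k) hahn \<Rightarrow> bool"  (infix "\<preceq>" 50)
  where "s \<preceq> t \<longleftrightarrow> \<not> t \<prec> s"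

text \<open>The relations \<open>\<prec>\<prec>\<close> and \<open>\<preceq>\<preceq>\<close> on nonzero series, relative to a logarithm.\<close>

definition flatter :: "(('r::linordered_field, 'n::linordered_ab_group_add, 'k::regular_uncountable) hahn
    \<Rightarrow> ('r, 'n, 'k) hahn) \<Rightarrow> ('r, 'n, 'k) hahn \<Rightarrow> ('r, 'n, 'k) hahn \<Rightarrow> bool"
  where "flatter Log s t \<longleftrightarrow> Log \<bar>s\<bar> \<prec> Log \<bar>t\<bar>"

definition flatter_eq :: "(('r::linordered_field, 'n::linordered_ab_group_add, 'k::regular_uncountable) hahn
    \<Rightarrow> ('r, 'n, 'k) hahn) \<Rightarrow> ('r, 'n, 'k) hahn \<Rightarrow> ('r, 'n, 'k) hahn \<Rightarrow> bool"
  where "flatter_eq Log s t \<longleftrightarrow> Log \<bar>s\<bar> \<preceq> Log \<bar>t\<bar>"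

definition pos_infinite :: "('r::linordered_field, 'n::linordered_ab_group_add, 'k::regular_uncountable) hahn set"
  where "pos_infinite = {s. \<forall>r. const r < s}"

text \<open>The field of series over a subgroup of the group of monomials, as a subset of the whole field.\<close>

definition series_over :: "'n::linordered_ab_group_add set
    \<Rightarrow> ('r::linordered_field, 'n, 'k::regular_uncountable) hahn set"
  where "series_over M = {s. supp s \<subseteq> M}"

definition monomial_subgroup :: "'n::linordered_ab_group_add set \<Rightarrow> bool"
  where "monomial_subgroup M \<longleftrightarrow> 0 \<in> M \<and> (\<forall>m\<in>M. \<forall>n\<in>M. m + n \<in> M) \<and> (\<forall>m\<in>M. - m \<in> M)"


section \<open>Summable families and strongly linear maps\<close>

definition summable_family :: "('i \<Rightarrow> ('r::linordered_field, 'n::linordered_ab_group_add, 'k::regular_uncountable) hahn)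
    \<Rightarrow> 'i set \<Rightarrow> bool"
  where "summable_family F I \<longleftrightarrow>
    wfp_on (\<Union>i\<in>I. supp (F i)) (>) \<and>
    |\<Union>i\<in>I. supp (F i)| <o |UNIV :: 'k set| \<and>
    (\<forall>m. finite {i\<in>I. m \<in> supp (F i)})"

definition family_sum :: "('i \<Rightarrow> ('r::linordered_field, 'n::linordered_ab_group_add, 'k::regular_uncountable) hahn)
    \<Rightarrow> 'i set \<Rightarrow> ('r, 'n, 'k) hahn"
  where "family_sum F I = Abs_hahn (\<lambda>m. \<Sum>i | i \<in> I \<and> m \<in> supp (F i). coeff (F i) m)"

lemma coeff_family_sum:
  fixes F :: "'i \<Rightarrow> ('r::linordered_field, 'n::linordered_ab_group_add, 'k::regular_uncountable) hahn"
  assumes "summable_family F I"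
  shows "coeff (family_sum F I) m = (\<Sum>i | i \<in> I \<and> m \<in> supp (F i). coeff (F i) m)"
proof -
  let ?c = "\<lambda>m. \<Sum>i | i \<in> I \<and> m \<in> supp (F i). coeff (F i) m"
  have "{m. ?c m \<noteq> 0} \<subseteq> (\<Union>i\<in>I. supp (F i))"
    by (auto elim!: sum.not_neutral_contains_not_neutral)
  then have "wfp_on {m. ?c m \<noteq> 0} (>) \<and> |{m. ?c m \<noteq> 0}| <o |UNIV :: 'k set|"
    using assms unfolding summable_family_def by (elim conjE) (rule hahn_closed)
  then show ?thesis by (simp add: family_sum_def Abs_hahn_inverse)
qed

text \<open>Preservation of sums is required for families indexed by classes of pairs of a monomial and a
  natural number.  This covers families over arbitrary index types: a summable family has only
  finitely many nonzero members with a given dominant monomial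
  (see \<open>strongly_linear_any_index\<close> below).\<close>

definition strongly_linear :: "(('r::linordered_field, 'n::linordered_ab_group_add, 'k::regular_uncountable) hahn
    \<Rightarrow> ('r, 'n, 'k) hahn) \<Rightarrow> bool"
  where "strongly_linear \<Phi> \<longleftrightarrow>
    (\<forall>s t. \<Phi> (s + t) = \<Phi> s + \<Phi> t) \<and>
    (\<forall>r s. \<Phi> (const r * s) = const r * \<Phi> s) \<and>
    (\<forall>(F :: 'n \<times> nat \<Rightarrow> ('r, 'n, 'k) hahn) I. summable_family F I \<longrightarrow>
       summable_family (\<lambda>i. \<Phi> (F i)) I \<and> \<Phi> (family_sum F I) = family_sum (\<lambda>i. \<Phi> (F i)) I)"

lemma summable_family_reindex:
  fixes F :: "'i \<Rightarrow> ('r::linordered_field, 'n::linordered_ab_group_add, 'k::regular_uncountable) hahn"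
    and G :: "'j \<Rightarrow> ('r, 'n, 'k) hahn"
  assumes J: "J \<subseteq> I" and zero: "\<And>i. i \<in> I - J \<Longrightarrow> F i = 0"
    and h: "inj_on h J" and G: "\<And>i. i \<in> J \<Longrightarrow> G (h i) = F i"
  shows "summable_family G (h ` J) \<longleftrightarrow> summable_family F I"
    and "family_sum G (h ` J) = family_sum F I"
proof -
  have ne: "i \<in> J" if "i \<in> I" "m \<in> supp (F i)" for i m
  proof (rule ccontr)
    assume "i \<notin> J"
    then have "F i = 0" using zero[of i] that by blast
    then show False using that by (simp add: supp_def zero_hahn.rep_eq)
  qed
  have set: "{j \<in> h ` J. m \<in> supp (G j)} = h ` {i\<in>I. m \<in> supp (F i)}" for m
  proof (rule equalityI; rule subsetI)
    fix j assume "j \<in> {j \<in> h ` J. m \<in> supp (G j)}"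
    then obtain i where "i \<in> J" "j = h i" "m \<in> supp (G (h i))" by blast
    then have "i \<in> {i\<in>I. m \<in> supp (F i)}" using J G[of i] by auto
    then show "j \<in> h ` {i\<in>I. m \<in> supp (F i)}" using \<open>j = h i\<close> by blast
  next
    fix j assume "j \<in> h ` {i\<in>I. m \<in> supp (F i)}"
    then obtain i where i: "i \<in> I" "m \<in> supp (F i)" "j = h i" by blast
    then have "i \<in> J" using ne by blast
    then show "j \<in> {j \<in> h ` J. m \<in> supp (G j)}" using i G[of i] by simp
  qed
  have inj: "inj_on h {i\<in>I. m \<in> supp (F i)}" for m
    using h by (rule inj_on_subset) (use ne in blast)
  have "(\<Union>j\<in>h ` J. supp (G j)) = (\<Union>i\<in>J. supp (F i))"
    using G by simp
  also have "\<dots> = (\<Union>i\<in>I. supp (F i))"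
    using ne J by blast
  finally have "(\<Union>j\<in>h ` J. supp (G j)) = (\<Union>i\<in>I. supp (F i))" .
  moreover have "finite {j \<in> h ` J. m \<in> supp (G j)} \<longleftrightarrow> finite {i\<in>I. m \<in> supp (F i)}" for m
    unfolding set using inj by (rule finite_image_iff)
  ultimately show "summable_family G (h ` J) \<longleftrightarrow> summable_family F I"
    unfolding summable_family_def by simp
  have "(\<Sum>j | j \<in> h ` J \<and> m \<in> supp (G j). coeff (G j) m) =
      (\<Sum>i | i \<in> I \<and> m \<in> supp (F i). coeff (F i) m)" for m
  proof -
    have "(\<Sum>j\<in>h ` {i\<in>I. m \<in> supp (F i)}. coeff (G j) m) =
        (\<Sum>i\<in>{i\<in>I. m \<in> supp (F i)}. coeff (G (h i)) m)"
      by (simp only: sum.reindex[OF inj] o_def)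
    also have "\<dots> = (\<Sum>i\<in>{i\<in>I. m \<in> supp (F i)}. coeff (F i) m)"
    proof (rule sum.cong[OF refl])
      fix i assume "i \<in> {i\<in>I. m \<in> supp (F i)}"
      then have "i \<in> J" using ne by blast
      then show "coeff (G (h i)) m = coeff (F i) m" by (simp only: G)
    qed
    finally show ?thesis unfolding set .
  qed
  then show "family_sum G (h ` J) = family_sum F I"
    unfolding family_sum_def by simp
qed

lemma strongly_linear_any_index:
  fixes F :: "'i \<Rightarrow> ('r::linordered_field, 'n::linordered_ab_group_add, 'k::regular_uncountable) hahn"
  assumes lin: "strongly_linear \<Phi>" and F: "summable_family F I"
  shows "summable_family (\<lambda>i. \<Phi> (F i)) I"
    and "\<Phi> (family_sum F I) = family_sum (\<lambda>i. \<Phi> (F i)) I"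
proof -
  define J where "J = {i\<in>I. F i \<noteq> 0}"
  define K where "K m = {i\<in>I. m \<in> supp (F i)}" for m
  have finK: "finite (K m)" for m using F by (simp add: summable_family_def K_def)
  define h where "h i = (dommon (F i), to_nat_on (K (dommon (F i))) i)" for i
  have K: "i \<in> K (dommon (F i))" if "i \<in> J" for i
    using that dommon(1)[of "F i"] by (simp add: J_def K_def supp_def)
  have h: "inj_on h J"
  proof (rule inj_onI)
    fix i j assume ij: "i \<in> J" "j \<in> J" "h i = h j"
    then have "dommon (F i) = dommon (F j)" by (simp add: h_def)
    then show "i = j"
      using ij K[of i] K[of j] inj_onD[OF inj_on_to_nat_on[OF countable_finite[OF finK]]]
      by (simp add: h_def)
  qed
  define G where "G j = F (the_inv_into J h j)" for j
  have G: "G (h i) = F i" if "i \<in> J" for i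
    using that by (simp add: G_def the_inv_into_f_f[OF h])
  have zero: "F i = 0" if "i \<in> I - J" for i
    using that by (simp add: J_def)
  have JI: "J \<subseteq> I" by (auto simp: J_def)
  have "\<Phi> (const 0 * 0) = const 0 * \<Phi> 0" using lin unfolding strongly_linear_def by blast
  moreover have "const 0 = (0 :: ('r, 'n, 'k) hahn)"
    by (rule hahn_eqI) (simp add: single.rep_eq zero_hahn.rep_eq)
  ultimately have \<Phi>0: "\<Phi> 0 = 0" by simp
  have FG: "summable_family G (h ` J) \<longleftrightarrow> summable_family F I"
    "family_sum G (h ` J) = family_sum F I"
    using summable_family_reindex[where F = F and G = G and h = h, OF JI zero h G] by blast+
  have \<Phi>zero: "\<Phi> (F i) = 0" if "i \<in> I - J" for i using zero[OF that] \<Phi>0 by simp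
  have \<Phi>G: "\<Phi> (G (h i)) = \<Phi> (F i)" if "i \<in> J" for i using G[OF that] by simp
  have \<Phi>FG: "summable_family (\<lambda>j. \<Phi> (G j)) (h ` J) \<longleftrightarrow> summable_family (\<lambda>i. \<Phi> (F i)) I"
    "family_sum (\<lambda>j. \<Phi> (G j)) (h ` J) = family_sum (\<lambda>i. \<Phi> (F i)) I"
    using summable_family_reindex[where F = "\<lambda>i. \<Phi> (F i)" and G = "\<lambda>j. \<Phi> (G j)" and h = h,
        OF JI \<Phi>zero h \<Phi>G] by blast+
  have "summable_family G (h ` J)" using F FG(1) by blast
  then have "summable_family (\<lambda>j. \<Phi> (G j)) (h ` J) \<and>
      \<Phi> (family_sum G (h ` J)) = family_sum (\<lambda>j. \<Phi> (G j)) (h ` J)"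
    using lin unfolding strongly_linear_def by blast
  then show "summable_family (\<lambda>i. \<Phi> (F i)) I"
    and "\<Phi> (family_sum F I) = family_sum (\<lambda>i. \<Phi> (F i)) I"
    using FG(2) \<Phi>FG by simp_all
qed


section \<open>The first-order theory of the real exponential field\<close>

datatype exp_term =
    TVar nat | TZero | TOne | TPlus exp_term exp_term | TTimes exp_term exp_term | TExp exp_term

datatype exp_formula =
    FEq exp_term exp_term | FLess exp_term exp_term
  | FNot exp_formula | FAnd exp_formula exp_formula | FAll nat exp_formula

primrec term_vars :: "exp_term \<Rightarrow> nat set" where
  "term_vars (TVar i) = {i}"
| "term_vars TZero = {}"
| "term_vars TOne = {}"
| "term_vars (TPlus t u) = term_vars t \<union> term_vars u"
| "term_vars (TTimes t u) = term_vars t \<union> term_vars u"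
| "term_vars (TExp t) = term_vars t"

primrec free_vars :: "exp_formula \<Rightarrow> nat set" where
  "free_vars (FEq t u) = term_vars t \<union> term_vars u"
| "free_vars (FLess t u) = term_vars t \<union> term_vars u"
| "free_vars (FNot \<phi>) = free_vars \<phi>"
| "free_vars (FAnd \<phi> \<psi>) = free_vars \<phi> \<union> free_vars \<psi>"
| "free_vars (FAll i \<phi>) = free_vars \<phi> - {i}"

primrec term_value :: "('r::linordered_field \<Rightarrow> 'r) \<Rightarrow> (nat \<Rightarrow> 'r) \<Rightarrow> exp_term \<Rightarrow> 'r" where
  "term_value E v (TVar i) = v i"
| "term_value E v TZero = 0"
| "term_value E v TOne = 1"
| "term_value E v (TPlus t u) = term_value E v t + term_value E v u"
| "term_value E v (TTimes t u) = term_value E v t * term_value E v u"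
| "term_value E v (TExp t) = E (term_value E v t)"

primrec satisfies :: "('r::linordered_field \<Rightarrow> 'r) \<Rightarrow> (nat \<Rightarrow> 'r) \<Rightarrow> exp_formula \<Rightarrow> bool" where
  "satisfies E v (FEq t u) \<longleftrightarrow> term_value E v t = term_value E v u"
| "satisfies E v (FLess t u) \<longleftrightarrow> term_value E v t < term_value E v u"
| "satisfies E v (FNot \<phi>) \<longleftrightarrow> \<not> satisfies E v \<phi>"
| "satisfies E v (FAnd \<phi> \<psi>) \<longleftrightarrow> satisfies E v \<phi> \<and> satisfies E v \<psi>"
| "satisfies E v (FAll i \<phi>) \<longleftrightarrow> (\<forall>a. satisfies E (v(i := a)) \<phi>)"

definition models_real_exp_theory :: "('r::linordered_field \<Rightarrow> 'r) \<Rightarrow> bool"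
  where "models_real_exp_theory E \<longleftrightarrow>
    (\<forall>\<phi>. free_vars \<phi> = {} \<longrightarrow>
       (\<forall>v. satisfies (exp :: real \<Rightarrow> real) v \<phi>) \<longrightarrow> (\<forall>v. satisfies E v \<phi>))"

text \<open>The exponential induced on the constants, i.e. the inverse of the restriction of the logarithm.\<close>

definition exp_const :: "(('r::linordered_field, 'n::linordered_ab_group_add, 'k::regular_uncountable) hahn
    \<Rightarrow> ('r, 'n, 'k) hahn) \<Rightarrow> 'r \<Rightarrow> 'r"
  where "exp_const Log r = (THE u. 0 < u \<and> Log (const u) = const r)"


section \<open>Transserial fields with derivation and composition\<close>

locale transserial_field =
  fixes Log :: "('r::linordered_field, 'n::linordered_ab_group_add, 'k::regular_uncountable) hahn
    \<Rightarrow> ('r, 'n, 'k) hahn"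
  assumes log_bij: "bij_betw Log {0<..} UNIV"
    and log_mult: "0 < s \<Longrightarrow> 0 < t \<Longrightarrow> Log (s * t) = Log s + Log t"
    and log_strict_mono: "strict_mono_on {0<..} Log"
    and supp_log_mono: "supp (Log (mon m)) \<subseteq> {0<..}"
    and log_le: "0 < s \<Longrightarrow> Log s \<le> s - 1"
    and log_one_plus: "\<epsilon> \<prec> 1 \<Longrightarrow>
      summable_family (\<lambda>k. const ((-1) ^ (k + 1) / of_nat k) * \<epsilon> ^ k) {0<..} \<and>
      Log (1 + \<epsilon>) = family_sum (\<lambda>k. const ((-1) ^ (k + 1) / of_nat k) * \<epsilon> ^ k) {0<..}"
    and log_const_bij: "bij_betw Log (const ` {0<..}) (range const)"

text \<open>\<open>\<partial>(Log \<bar>s\<bar>) = \<partial>(s) / s\<close> is stated without division, the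
  type of series being registered as an ordered integral domain only (it is in fact a field).\<close>

locale transserial_derivation = transserial_field Log
  for Log :: "('r::linordered_field, 'n::linordered_ab_group_add, 'k::regular_uncountable) hahn
    \<Rightarrow> ('r, 'n, 'k) hahn" +
  fixes D :: "('r, 'n, 'k) hahn \<Rightarrow> ('r, 'n, 'k) hahn"
    and x :: "('r, 'n, 'k) hahn"
  assumes D_strongly_linear: "strongly_linear D"
    and D_mult: "D (s * t) = D s * t + s * D t"
    and D_log: "s \<noteq> 0 \<Longrightarrow> D (Log \<bar>s\<bar>) * s = D s"
    and D_surj: "surj D"
    and x_pos: "0 < x"
    and x_no_constant_term: "0 \<notin> supp x"
    and D_x: "D x = 1"
    and D_flat: "n \<in> supp (D (mon m)) \<Longrightarrow>
      \<exists>f w. flatter Log (mon f) (mon m) \<and> flatter_eq Log (mon w) x \<and> n = m + f + w"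
    and D_kernel: "{s. D s = 0} = range const"
    and D_pos_infinite: "s \<in> pos_infinite \<Longrightarrow> 0 < D s"

locale transserial_composition = transserial_derivation Log D x
  for Log :: "('r::linordered_field, 'n::linordered_ab_group_add, 'k::regular_uncountable) hahn
    \<Rightarrow> ('r, 'n, 'k) hahn"
    and D x +
  fixes cmp :: "('r, 'n, 'k) hahn \<Rightarrow> ('r, 'n, 'k) hahn \<Rightarrow> ('r, 'n, 'k) hahn"  (infixl "\<odot>" 75)
  assumes compose_strongly_linear: "s \<in> pos_infinite \<Longrightarrow> strongly_linear (\<lambda>f. f \<odot> s)"
    and compose_one: "s \<in> pos_infinite \<Longrightarrow> 1 \<odot> s = 1"
    and compose_mult: "s \<in> pos_infinite \<Longrightarrow> (f * g) \<odot> s = (f \<odot> s) * (g \<odot> s)"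
    and compose_mono: "s \<in> pos_infinite \<Longrightarrow> f \<le> g \<Longrightarrow> f \<odot> s \<le> g \<odot> s"
    and compose_log: "s \<in> pos_infinite \<Longrightarrow> 0 < f \<Longrightarrow> Log f \<odot> s = Log (f \<odot> s)"
    and compose_assoc: "s \<in> pos_infinite \<Longrightarrow> t \<in> pos_infinite \<Longrightarrow> f \<odot> (s \<odot> t) = (f \<odot> s) \<odot> t"
    and x_compose: "s \<in> pos_infinite \<Longrightarrow> x \<odot> s = s"
    and compose_x: "f \<odot> x = f"
    and compose_flat: "s \<in> pos_infinite \<Longrightarrow> m \<noteq> 0 \<Longrightarrow> n \<in> supp (mon m \<odot> s) \<Longrightarrow>
      \<exists>f w. \<exists>u\<in>supp s. flatter Log (mon f) (mon m) \<and> mon w \<preceq> (1 :: ('r, 'n, 'k) hahn) \<and>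
        flatter_eq Log (mon w) (mon u) \<and> n = dommon (mon m \<odot> s) + f + w"
    and chain_rule: "s \<in> pos_infinite \<Longrightarrow> D (f \<odot> s) = D s * (D f \<odot> s)"
    and taylor: "s \<in> pos_infinite \<Longrightarrow> \<delta> \<prec> s \<Longrightarrow>
      (\<And>m. m \<in> supp f \<Longrightarrow> (D (mon m) \<odot> s) * \<delta> \<prec> mon m \<odot> s) \<Longrightarrow>
      summable_family (\<lambda>(m, k). ((D ^^ k) (mon m) \<odot> s) * \<delta> ^ k) (supp f \<times> UNIV) \<and>
      summable_family (\<lambda>k. const (1 / fact k) * ((D ^^ k) f \<odot> s) * \<delta> ^ k) UNIV \<and>
      f \<odot> (s + \<delta>) = family_sum (\<lambda>k. const (1 / fact k) * ((D ^^ k) f \<odot> s) * \<delta> ^ k) UNIV \<and>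
      f \<odot> (s + \<delta>) =
        family_sum (\<lambda>(m, k). const (coeff f m / fact k) * ((D ^^ k) (mon m) \<odot> s) * \<delta> ^ k)
          (supp f \<times> UNIV) \<and>
      (\<forall>k. ((D ^^ k) f \<odot> s) * \<delta> ^ k \<noteq> 0 \<longrightarrow>
         ((D ^^ (k + 1)) f \<odot> s) * \<delta> ^ (k + 1) \<prec> ((D ^^ k) f \<odot> s) * \<delta> ^ k)"
    and compose_group: "group \<lparr>carrier = pos_infinite, mult = (\<odot>), one = x\<rparr>"
    and compose_increasing: "f \<notin> range const \<Longrightarrow> 0 < D f \<Longrightarrow>
      strict_mono_on pos_infinite (\<lambda>s. f \<odot> s)"
    and compose_decreasing: "f \<notin> range const \<Longrightarrow> D f < 0 \<Longrightarrow>
      strict_antimono_on pos_infinite (\<lambda>s. f \<odot> s)"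


section \<open>Steep conjugates\<close>

text \<open>\<open>x\<close> lies in a group of monomials when it is, as a series, one of its monomials.  That the series
  over a subgroup form a subfield is automatic, so being a differential subfield amounts to closure
  under the derivation.\<close>

definition steep_subfield :: "(('r::linordered_field, 'n::linordered_ab_group_add, 'k::regular_uncountable) hahn
    \<Rightarrow> ('r, 'n, 'k) hahn) \<Rightarrow> (('r, 'n, 'k) hahn \<Rightarrow> ('r, 'n, 'k) hahn)
    \<Rightarrow> ('r, 'n, 'k) hahn \<Rightarrow> 'n set \<Rightarrow> 'n set \<Rightarrow> bool"
  where "steep_subfield Log D x M U \<longleftrightarrow>
    U \<subseteq> M \<and> monomial_subgroup U \<and> x \<in> mon ` U \<and>
    D ` series_over U \<subseteq> series_over U \<and>
    (\<forall>u\<in>U - {0}. flatter_eq Log x (mon u))"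

definition steep_conjugate :: "(('r::linordered_field, 'n::linordered_ab_group_add, 'k::regular_uncountable) hahn
    \<Rightarrow> ('r, 'n, 'k) hahn) \<Rightarrow> (('r, 'n, 'k) hahn \<Rightarrow> ('r, 'n, 'k) hahn)
    \<Rightarrow> ('r, 'n, 'k) hahn \<Rightarrow> (('r, 'n, 'k) hahn \<Rightarrow> ('r, 'n, 'k) hahn \<Rightarrow> ('r, 'n, 'k) hahn)
    \<Rightarrow> 'n set \<Rightarrow> 'n set \<Rightarrow> bool"
  where "steep_conjugate Log D x cmp M U \<longleftrightarrow>
    steep_subfield Log D x M U \<and>
    (\<forall>f \<in> series_over M \<inter> pos_infinite. x < f \<longrightarrow>
       (\<exists>V \<in> series_over M \<inter> pos_infinite. \<exists>\<epsilon> \<in> series_over U.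
          \<epsilon> \<prec> 1 \<and> 0 < \<epsilon> \<and> cmp V f = cmp (x + \<epsilon>) V))"

end

theory Submission
  imports Defs
begin

text \<open>
  Conjugation by the series provided by the steep conjugate reduces the equation \<open>V \<odot> f = V + 1\<close> to
  \<open>\<Delta> W = 1\<close> with \<open>\<Delta> W = W \<odot> (x + \<epsilon>) - W\<close>, for an infinitesimal \<open>\<epsilon> > 0\<close>: if \<open>V \<odot> f = (x + \<epsilon>) \<odot> V\<close>,
  then \<open>W \<odot> V\<close> is a solution.  The operator \<open>\<Delta>\<close> is shown to map the series over \<open>M\<close> onto themselves.

  Monotonicity of composition says that \<open>\<Delta> W > 0\<close> whenever \<open>W' > 0\<close>.  As \<open>\<Delta>\<close> is linear over the constants,
  \<open>V' \<prec> W'\<close> implies \<open>\<Delta> V \<prec> \<Delta> W\<close>, and so does \<open>V \<prec> W\<close> if \<open>W\<close> is not of the size of a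
  constant (\<open>difference_dominated\<close>).  Hence the dominant monomial of \<open>\<Delta> W\<close> depends, in a strictly
  increasing way, only on the one of \<open>W\<close>, once the constant term of \<open>W\<close> has been removed.

  Each monomial \<open>m\<close> is the dominant monomial of some \<open>\<Delta> n\<close> (\<open>difference_onto_monomials\<close>).  If
  \<open>m \<odot> (x + \<epsilon>) \<sim> c m\<close> with a constant \<open>c \<noteq> 1\<close> (\<open>c = 0\<close> meaning \<open>m \<odot> (x + \<epsilon>) \<prec> m\<close>), then \<open>\<Delta> m \<sim> (c - 1) m\<close>.  If \<open>m \<odot> (x + \<epsilon>)\<close>
  dominates \<open>m\<close>, one takes the composite of \<open>m\<close> with the inverse of \<open>x + \<epsilon>\<close> instead.  If
  \<open>m \<odot> (x + \<epsilon>) \<sim> m\<close>, one takes a monomial \<open>n\<close> with \<open>n' \<epsilon>\<close> of the size of \<open>m\<close>.  The Taylor expansion of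
  \<open>n\<close> at \<open>x\<close> gives \<open>\<Delta> n \<sim> n' \<epsilon>\<close>, provided that \<open>m \<prec> n\<close>.  For \<open>m = 1\<close> this is clear, as \<open>n' \<succ> 1 = x'\<close>
  forces \<open>n \<succ> x\<close>.  For \<open>m \<noteq> 1\<close>, failure would mean that \<open>(log m)'\<close> is at least of the size of
  \<open>\<epsilon>\<^sup>-\<^sup>1\<close>, and monotonicity, compared with the case \<open>m = 1\<close>, would give \<open>\<Delta> (log m) \<succeq> 1\<close>; but
  \<open>\<Delta> (log m)\<close> is infinitesimal if \<open>m \<odot> (x + \<epsilon>) \<sim> m\<close>.

  So \<open>\<Delta>\<close> induces an increasing bijection from the monomials other than 1 onto all monomials.  For a
  strongly linear map this implies surjectivity (\<open>strongly_linear_surj\<close>), by successive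
  approximation.
\<close>

section \<open>Dominant monomials and asymptotic comparison\<close>

lemma coeff_zero [simp]: "coeff 0 m = 0"
  by (simp add: zero_hahn.rep_eq)

lemma coeff_add [simp]: "coeff (s + t) m = coeff s m + coeff t m"
  by (simp add: plus_hahn.rep_eq)

lemma coeff_minus [simp]: "coeff (- s) m = - coeff s m"
  by (simp add: uminus_hahn.rep_eq)

lemma coeff_diff [simp]: "coeff (s - t) m = coeff s m - coeff t m"
  unfolding minus_hahn_def coeff_add coeff_minus by simp

lemma coeff_const_times [simp]: "coeff (const c * t) m = c * coeff t m"
  by (simp add: coeff_single_times)

lemma coeff_mon [simp]: "coeff (mon m) n = (if n = m then 1 else 0)"
  by (simp add: mon_def single.rep_eq)

lemma coeff_mon_times [simp]: "coeff (mon n * t) m = coeff t (m - n)"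
  by (simp add: mon_def coeff_single_times)

lemma const_zero [simp]: "const 0 = 0"
  by (rule hahn_eqI) (simp add: single.rep_eq)

lemma const_one: "const 1 = 1"
  by (simp add: one_hahn_def)

lemma mon_zero: "mon 0 = 1"
  by (simp add: mon_def one_hahn_def)

lemma mon_neq_zero [simp]: "mon m \<noteq> 0"
  by (metis coeff_mon coeff_zero zero_neq_one)

lemma dommon_mon [simp]: "dommon (mon m) = m"
  by (rule dommon_eqI) auto

lemma dommon_one [simp]: "dommon 1 = 0"
  by (simp flip: mon_zero)

lemma mon_add: "mon (m + n) = mon m * mon n"
  by (rule hahn_eqI) (auto simp: algebra_simps)

lemma hahn_pos_iff: "0 < s \<longleftrightarrow> (\<exists>m. 0 < coeff s m \<and> (\<forall>n>m. coeff s n = 0))"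
  by (simp add: less_hahn_def hpos_iff)

lemma hahn_pos_iff_dommon: "0 < s \<longleftrightarrow> s \<noteq> 0 \<and> 0 < coeff s (dommon s)"
  by (simp add: less_hahn_def hpos_def)

lemma mon_pos [simp]: "0 < mon m"
  by (simp add: hahn_pos_iff_dommon)

lemma supp_mon: "supp (mon m) = {m}"
  by (auto simp: supp_def)

lemma supp_add: "supp (s + t) \<subseteq> supp s \<union> supp t"
  by (auto simp: supp_def)

lemma supp_diff: "supp (s - t) \<subseteq> supp s \<union> supp t"
  by (auto simp: supp_def)

lemma dommon_minus [simp]: "dommon (- s) = dommon s"
  by (simp add: dommon_def supp_def)

lemma dommon_in_supp: "s \<noteq> 0 \<Longrightarrow> dommon s \<in> supp s"
  using dommon(1) by (simp add: supp_def)

lemma le_dommon: "m \<in> supp s \<Longrightarrow> m \<le> dommon s"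
  using dommon(2)[of s m] by (force simp: supp_def)

lemma dominated_iff: "s \<prec> t \<longleftrightarrow> t \<noteq> 0 \<and> (\<forall>j\<ge>dommon t. coeff s j = 0)"
proof
  assume st: "s \<prec> t"
  have "const 1 * \<bar>s\<bar> < \<bar>t\<bar>" using st zero_less_one unfolding dominated_def by blast
  then have t: "t \<noteq> 0" by (auto simp: const_one)
  have "coeff s j = 0" if j: "dommon t \<le> j" for j
  proof (rule ccontr)
    assume nz: "coeff s j \<noteq> 0"
    then have s: "s \<noteq> 0" by auto
    let ?d = "dommon s"
    have d: "dommon t \<le> ?d" using le_dommon[of j s] nz j by (simp add: supp_def)
    define r where "r = (\<bar>coeff t ?d\<bar> + 1) / \<bar>coeff s ?d\<bar>"
    have cs: "coeff s ?d \<noteq> 0" using dommon(1)[OF s] .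
    then have r: "0 < r" "r * \<bar>coeff s ?d\<bar> = \<bar>coeff t ?d\<bar> + 1"
      by (simp_all add: r_def add_nonneg_pos)
    have "coeff \<bar>s\<bar> ?d = \<bar>coeff s ?d\<bar>"
      using cs s hahn_pos_iff_dommon[of s] hahn_pos_iff_dommon[of "-s"]
      by (auto simp: abs_hahn_def abs_if)
    moreover have "coeff \<bar>t\<bar> ?d \<le> \<bar>coeff t ?d\<bar>" by (auto simp: abs_hahn_def abs_if)
    ultimately have "0 < coeff (const r * \<bar>s\<bar> - \<bar>t\<bar>) ?d" using r(2) by simp
    moreover have "\<forall>n>?d. coeff (const r * \<bar>s\<bar> - \<bar>t\<bar>) n = 0"
      using dommon(2)[OF s] dommon(2)[OF t] d by (auto simp: abs_hahn_def)
    ultimately have "0 < const r * \<bar>s\<bar> - \<bar>t\<bar>" unfolding hahn_pos_iff by blast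
    then show False using st r(1) unfolding dominated_def by (meson diff_gt_0_iff_gt less_asym)
  qed
  then show "t \<noteq> 0 \<and> (\<forall>j\<ge>dommon t. coeff s j = 0)" using t by blast
next
  assume *: "t \<noteq> 0 \<and> (\<forall>j\<ge>dommon t. coeff s j = 0)"
  let ?d = "dommon t"
  have zero: "coeff \<bar>s\<bar> j = 0" if "?d \<le> j" for j using * that by (simp add: abs_hahn_def)
  have "coeff \<bar>t\<bar> ?d = \<bar>coeff t ?d\<bar>"
    using * hahn_pos_iff_dommon[of t] hahn_pos_iff_dommon[of "-t"] dommon(1)[of t]
    by (auto simp: abs_hahn_def abs_if)
  then have pos: "0 < coeff \<bar>t\<bar> ?d" using * dommon(1)[of t] by simp
  have high: "coeff \<bar>t\<bar> n = 0" if "?d < n" for n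
    using * dommon(2)[of t n] that by (simp add: abs_hahn_def)
  have "0 < \<bar>t\<bar> - const r * \<bar>s\<bar>" for r
    unfolding hahn_pos_iff using zero pos high by (intro exI[of _ ?d]) auto
  then show "s \<prec> t" unfolding dominated_def by (metis diff_gt_0_iff_gt)
qed

lemma dominated_iff_dommon: "s \<prec> t \<longleftrightarrow> t \<noteq> 0 \<and> (s = 0 \<or> dommon s < dommon t)"
proof (cases "s = 0")
  case False
  have "(\<forall>j\<ge>d. coeff s j = 0) \<longleftrightarrow> dommon s < d" for d
    using dommon(1)[OF False] dommon(2)[OF False] by (meson leI less_le_trans)
  then show ?thesis using False by (simp add: dominated_iff)
qed (simp add: dominated_iff)

lemma dominated_trans: "s \<prec> t \<Longrightarrow> t \<prec> u \<Longrightarrow> s \<prec> u"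
  by (auto simp: dominated_iff_dommon)

lemma dominated_diff: "s \<prec> u \<Longrightarrow> t \<prec> u \<Longrightarrow> s - t \<prec> u"
  by (simp add: dominated_iff)

lemma dominated_const_times: "s \<prec> u \<Longrightarrow> const c * s \<prec> u"
  by (simp add: dominated_iff)

lemma dominated_minus_right [simp]: "s \<prec> - t \<longleftrightarrow> s \<prec> t"
  by (simp add: dominated_iff)

lemma dominated_one_iff: "s \<prec> 1 \<longleftrightarrow> (\<forall>j\<ge>0. coeff s j = 0)"
  by (simp add: dominated_iff)

text \<open>For \<open>t > 0\<close>, domination can be tested against all constant multiples, of either sign.\<close>

lemma dominatedI: "(\<And>r. const r * s < t) \<Longrightarrow> s \<prec> t"
proof -
  assume *: "\<And>r. const r * s < t"
  have t: "0 < t" using *[of 0] by simp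
  have "const (- r) * s = - (const r * s)" for r by (rule hahn_eqI) simp
  then have "const r * \<bar>s\<bar> < t" for r
    using *[of r] *[of "- r"] by (cases "s < 0") (simp_all add: abs_hahn_def)
  then show ?thesis using t by (simp add: dominated_def)
qed

lemma dominatedD:
  assumes "s \<prec> t" "0 < t"
  shows "0 < t - const r * s"
proof -
  have t: "t \<noteq> 0" and s: "\<forall>j\<ge>dommon t. coeff s j = 0"
    using assms(1) by (simp_all add: dominated_iff)
  have "0 < coeff (t - const r * s) (dommon t)"
    using s assms(2) by (simp add: hahn_pos_iff_dommon)
  moreover have "\<forall>n>dommon t. coeff (t - const r * s) n = 0"
    using s dommon(2)[OF t] by simp
  ultimately show ?thesis unfolding hahn_pos_iff by blast
qed

lemma dommon_cong:
  assumes "s - const c * t \<prec> t" "c \<noteq> 0"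
  shows "s \<noteq> 0" and "dommon s = dommon t"
proof -
  have t: "t \<noteq> 0" and st: "\<And>j. dommon t \<le> j \<Longrightarrow> coeff s j = c * coeff t j"
    using assms(1) by (simp_all add: dominated_iff)
  have nz: "coeff s (dommon t) \<noteq> 0" using st[of "dommon t"] dommon(1)[OF t] assms(2) by simp
  then show "s \<noteq> 0" by auto
  show "dommon s = dommon t"
    by (rule dommon_eqI[OF nz]) (use st dommon(2)[OF t] in auto)
qed

lemma same_dommon_scale:
  assumes "s \<noteq> 0" "t \<noteq> 0" "dommon s = dommon t"
  obtains c where "c \<noteq> 0" "s - const c * t \<prec> t"
proof
  let ?c = "coeff s (dommon t) / coeff t (dommon t)"
  show "?c \<noteq> 0" using dommon(1)[OF assms(1)] dommon(1)[OF assms(2)] assms(3) by simp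
  have "coeff (s - const ?c * t) j = 0" if "dommon t \<le> j" for j
    using that dommon[OF assms(1)] dommon[OF assms(2)] assms(3)
    by (cases "j = dommon t") auto
  then show "s - const ?c * t \<prec> t" using assms(2) unfolding dominated_iff by blast
qed

lemma dommon_mon_times: "t \<noteq> 0 \<Longrightarrow> dommon (mon n * t) = n + dommon t"
  by (rule dommon_eqI) (simp_all add: dommon(1) dommon(2) less_diff_eq add.commute)

lemma dommon_times:
  assumes "s \<noteq> 0" "t \<noteq> 0"
  shows "dommon (s * t) = dommon s + dommon t"
proof -
  obtain c where c: "c \<noteq> 0" "s - const c * mon (dommon s) \<prec> mon (dommon s)"
    using same_dommon_scale[OF assms(1) mon_neq_zero, of "dommon s"] by auto
  have mult: "u * t \<prec> v * t" if "u \<prec> v" for u v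
    using that assms(2) unfolding dominated_def by (simp add: abs_mult mult.assoc[symmetric])
  have "s * t - const c * (mon (dommon s) * t) \<prec> mon (dommon s) * t"
    using mult[OF c(2)] by (simp add: left_diff_distrib mult.assoc)
  then have "dommon (s * t) = dommon (mon (dommon s) * t)"
    using c(1) by (rule dommon_cong)
  then show ?thesis by (simp add: dommon_mon_times[OF assms(2)])
qed

lemma pos_infinite_iff: "s \<in> pos_infinite \<longleftrightarrow> 0 < s \<and> 0 < dommon s"
proof
  assume s: "s \<in> pos_infinite"
  have "const r * 1 < s" for r using s by (simp add: pos_infinite_def)
  then have "1 \<prec> s" by (rule dominatedI)
  then have "0 < dommon s" by (simp add: dominated_iff_dommon)
  moreover have "const 0 < s" using s unfolding pos_infinite_def by blast
  then have "0 < s" by simp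
  ultimately show "0 < s \<and> 0 < dommon s" by simp
next
  assume s: "0 < s \<and> 0 < dommon s"
  then have "1 \<prec> s" by (auto simp: dominated_iff_dommon)
  then show "s \<in> pos_infinite" using dominatedD[of 1 s] s by (simp add: pos_infinite_def)
qed


section \<open>Strongly linear maps\<close>

lemma strongly_linear_add: "strongly_linear L \<Longrightarrow> L (s + t) = L s + L t"
  by (simp add: strongly_linear_def)

lemma strongly_linear_scale: "strongly_linear L \<Longrightarrow> L (const c * s) = const c * L s"
  by (simp add: strongly_linear_def)

lemma strongly_linear_zero: "strongly_linear L \<Longrightarrow> L 0 = 0"
  using strongly_linear_scale[of L 0 0] by simp

lemma strongly_linear_diff:
  assumes "strongly_linear L"
  shows "L (s - t) = L s - L t"
  using strongly_linear_add[OF assms, of "s - t" t] by (simp add: algebra_simps)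

lemma strongly_linear_minus: "strongly_linear L \<Longrightarrow> L (- s) = - L s"
  using strongly_linear_diff[of L 0 s] by (simp add: strongly_linear_zero)

lemma summable_family_diff:
  fixes F G :: "'i \<Rightarrow> ('r::linordered_field, 'n::linordered_ab_group_add, 'k::regular_uncountable) hahn"
  assumes F: "summable_family F I" and G: "summable_family G I"
  shows "summable_family (\<lambda>i. F i - G i) I"
    and "family_sum (\<lambda>i. F i - G i) I = family_sum F I - family_sum G I"
proof -
  let ?UF = "\<Union>i\<in>I. supp (F i)" and ?UG = "\<Union>i\<in>I. supp (G i)" and ?H = "\<lambda>i. F i - G i"
  have supp: "supp (?H i) \<subseteq> supp (F i) \<union> supp (G i)" for i by (rule supp_diff)
  then have sub: "(\<Union>i\<in>I. supp (?H i)) \<subseteq> ?UF \<union> ?UG" by blast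
  have "wfp_on (?UF \<union> ?UG) (>)"
    using F G unfolding summable_family_def by (blast intro: wfp_on_greater_Un)
  then have wfp: "wfp_on (\<Union>i\<in>I. supp (?H i)) (>)" using sub by (rule wfp_on_subset)
  have "|?UF \<union> ?UG| <o |UNIV :: 'k set|"
    using F G unfolding summable_family_def by (blast intro: small_Un)
  then have small: "|\<Union>i\<in>I. supp (?H i)| <o |UNIV :: 'k set|"
    by (rule ordLeq_ordLess_trans[OF card_of_mono1[OF sub]])
  let ?S = "\<lambda>m. {i\<in>I. m \<in> supp (F i)} \<union> {i\<in>I. m \<in> supp (G i)}"
  have fin: "finite (?S m)" for m
    using F G unfolding summable_family_def by blast
  have "{i\<in>I. m \<in> supp (?H i)} \<subseteq> ?S m" for m using supp by blast
  then have "finite {i\<in>I. m \<in> supp (?H i)}" for m using fin by (rule finite_subset)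
  then show H: "summable_family ?H I"
    using wfp small unfolding summable_family_def by blast
  have expand: "coeff (family_sum E I) m = (\<Sum>i\<in>?S m. coeff (E i) m)"
    if E: "summable_family E I" and "\<And>i. supp (E i) \<subseteq> supp (F i) \<union> supp (G i)" for E m
    unfolding coeff_family_sum[OF E]
    by (rule sum.mono_neutral_left[OF fin]) (use that in \<open>auto simp: supp_def\<close>)
  show "family_sum ?H I = family_sum F I - family_sum G I"
    by (rule hahn_eqI)
      (simp add: expand[OF H supp] expand[OF F] expand[OF G] sum_subtractf)
qed

lemma strongly_linear_sub_identity:
  assumes L: "strongly_linear L"
  shows "strongly_linear (\<lambda>f. L f - f)"
  unfolding strongly_linear_def
proof (intro conjI allI impI)
  fix s t r
  show "L (s + t) - (s + t) = L s - s + (L t - t)"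
    by (simp add: strongly_linear_add[OF L])
  show "L (const r * s) - const r * s = const r * (L s - s)"
    by (simp add: strongly_linear_scale[OF L] right_diff_distrib)
next
  fix F :: "'b \<times> nat \<Rightarrow> ('a, 'b, 'c) hahn" and I
  assume F: "summable_family F I"
  then have "summable_family (\<lambda>i. L (F i)) I" "L (family_sum F I) = family_sum (\<lambda>i. L (F i)) I"
    using L unfolding strongly_linear_def by blast+
  then show "summable_family (\<lambda>i. L (F i) - F i) I"
    and "L (family_sum F I) - family_sum F I = family_sum (\<lambda>i. L (F i) - F i) I"
    using summable_family_diff[OF _ F] by simp_all
qed

text \<open>A strongly linear map is determined by its values on monomials.\<close>

lemma coeff_strongly_linear:
  fixes L :: "('r::linordered_field, 'n::linordered_ab_group_add, 'k::regular_uncountable) hahn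
    \<Rightarrow> ('r, 'n, 'k) hahn"
  assumes L: "strongly_linear L"
  shows "coeff (L p) j =
    (\<Sum>k | k \<in> supp p \<and> j \<in> supp (L (mon k)). coeff p k * coeff (L (mon k)) j)"
proof -
  define F where "F k = const (coeff p k) * (mon k :: ('r, 'n, 'k) hahn)" for k
  have suppF: "supp (F k) = {k}" if "k \<in> supp p" for k
    using that by (auto simp: F_def supp_def)
  have "(\<Union>k\<in>supp p. supp (F k)) = supp p" using suppF by simp
  moreover have fib: "{k \<in> supp p. m \<in> supp (F k)} = (if m \<in> supp p then {m} else {})" for m
    using suppF by auto
  ultimately have F: "summable_family F (supp p)"
    unfolding summable_family_def using wfp_on_supp small_supp by auto
  have "family_sum F (supp p) = p"
    by (rule hahn_eqI) (auto simp: coeff_family_sum[OF F] fib, auto simp: F_def supp_def)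
  then have "coeff (L p) j = coeff (family_sum (\<lambda>k. L (F k)) (supp p)) j"
    using strongly_linear_any_index(2)[OF L F] by simp
  also have "\<dots> = (\<Sum>k | k \<in> supp p \<and> j \<in> supp (L (F k)). coeff (L (F k)) j)"
    by (rule coeff_family_sum[OF strongly_linear_any_index(1)[OF L F]])
  also have "\<dots> = (\<Sum>k | k \<in> supp p \<and> j \<in> supp (L (mon k)). coeff p k * coeff (L (mon k)) j)"
    by (rule sum.cong) (auto simp: F_def supp_def strongly_linear_scale[OF L])
  finally show ?thesis .
qed

lemma supp_strongly_linear:
  assumes "strongly_linear L"
  shows "supp (L p) \<subseteq> (\<Union>k\<in>supp p. supp (L (mon k)))"
proof
  fix j assume "j \<in> supp (L p)"
  then have "(\<Sum>k | k \<in> supp p \<and> j \<in> supp (L (mon k)). coeff p k * coeff (L (mon k)) j) \<noteq> 0"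
    unfolding coeff_strongly_linear[OF assms, of p j, symmetric] by (simp add: supp_def)
  then have "{k. k \<in> supp p \<and> j \<in> supp (L (mon k))} \<noteq> {}" by (metis (lifting) sum.empty)
  then show "j \<in> (\<Union>k\<in>supp p. supp (L (mon k)))" by blast
qed

lemma dommon_strongly_linear:
  assumes L: "strongly_linear L" and p: "p \<noteq> 0" and nz: "L (mon (dommon p)) \<noteq> 0"
    and dom: "\<And>k. k \<in> supp p \<Longrightarrow> k < dommon p \<Longrightarrow> L (mon k) \<prec> L (mon (dommon p))"
  shows "L p \<noteq> 0" and "dommon (L p) = dommon (L (mon (dommon p)))"
proof -
  let ?d = "dommon p"
  have "coeff (L p) j = coeff p ?d * coeff (L (mon ?d)) j" if j: "dommon (L (mon ?d)) \<le> j" for j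
  proof -
    have "k = ?d" if "k \<in> supp p" "j \<in> supp (L (mon k))" for k
    proof (rule ccontr)
      assume "k \<noteq> ?d"
      then have "L (mon k) \<prec> L (mon ?d)" using le_dommon[OF that(1)] dom[OF that(1)] by simp
      then show False using that(2) j by (simp add: dominated_iff supp_def)
    qed
    then have fib: "{k. k \<in> supp p \<and> j \<in> supp (L (mon k))} = {k. k = ?d \<and> j \<in> supp (L (mon ?d))}"
      using dommon_in_supp[OF p] by blast
    show ?thesis
      unfolding coeff_strongly_linear[OF L, of p j] fib
      by (cases "j \<in> supp (L (mon ?d))") (simp_all add: supp_def)
  qed
  then have "L p - const (coeff p ?d) * L (mon ?d) \<prec> L (mon ?d)"
    using nz by (simp add: dominated_iff)
  then show "L p \<noteq> 0" "dommon (L p) = dommon (L (mon ?d))"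
    using dommon_cong dommon(1)[OF p] by blast+
qed

text \<open>If a strongly linear map respects domination by series that are not of the size of a constant, and
  kills constants, then the dominant monomials of its values are attained at monomials.\<close>

lemma dommon_value_monomial:
  assumes L: "strongly_linear L"
    and dom: "\<And>s t. s \<prec> t \<Longrightarrow> dommon t \<noteq> 0 \<Longrightarrow> L s \<prec> L t"
    and L_const: "\<And>c. L (const c) = 0"
    and h: "h \<in> series_over M" "L h \<noteq> 0"
  obtains n where "n \<in> M - {0}" "L (mon n) \<noteq> 0" "dommon (L (mon n)) = dommon (L h)"
proof
  define t where "t = h - const (coeff h 0)"
  have Lt: "L t = L h" by (simp add: t_def strongly_linear_diff[OF L] L_const)
  then have "t \<noteq> 0" using h(2) strongly_linear_zero[OF L] by auto
  have "coeff t 0 = 0" by (simp add: t_def single.rep_eq)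
  then have d: "dommon t \<noteq> 0" using dommon(1)[OF \<open>t \<noteq> 0\<close>] by auto
  have "coeff t (dommon t) = coeff h (dommon t)" using d by (simp add: t_def single.rep_eq)
  then have "dommon t \<in> supp h" using dommon(1)[OF \<open>t \<noteq> 0\<close>] by (simp add: supp_def)
  then show "dommon t \<in> M - {0}" using h(1) d by (auto simp: series_over_def)
  have "0 \<prec> mon (dommon t)" by (simp add: dominated_iff)
  then show nz: "L (mon (dommon t)) \<noteq> 0"
    using dom[of 0 "mon (dommon t)"] d by (simp add: dominated_iff)
  have "L (mon k) \<prec> L (mon (dommon t))" if "k < dommon t" for k
    using dom[of "mon k" "mon (dommon t)"] that d by (simp add: dominated_iff_dommon)
  then show "dommon (L (mon (dommon t))) = dommon (L h)"
    using dommon_strongly_linear(2)[OF L \<open>t \<noteq> 0\<close> nz] Lt by simp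
qed


section \<open>Surjectivity of strongly linear maps\<close>

lemma small_UNION:
  assumes "|A| <o |UNIV :: 'k::regular_uncountable set|"
    and "\<And>a. a \<in> A \<Longrightarrow> |F a| <o |UNIV :: 'k set|"
  shows "|\<Union>a\<in>A. F a| <o |UNIV :: 'k set|"
proof (rule stable_UNION)
  show "stable |UNIV :: 'k set|"
    by (rule regularCard_stable)
      (simp_all only: Field_card_of infinite_UNIV_regular_uncountable regular_UNIV card_of_card_order_on not_False_eq_True)
qed (use assms in auto)

text \<open>
  A small set of monomials lies in a small set that is closed under a map with small values.
\<close>

lemma small_closure:
  fixes F :: "'a \<Rightarrow> 'a set"
  assumes A: "|A| <o |UNIV :: 'k::regular_uncountable set|" "A \<subseteq> M"
    and F: "\<And>a. a \<in> M \<Longrightarrow> |F a| <o |UNIV :: 'k set|" "\<And>a. a \<in> M \<Longrightarrow> F a \<subseteq> M"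
  obtains B where "A \<subseteq> B" "B \<subseteq> M" "|B| <o |UNIV :: 'k set|" "\<And>b. b \<in> B \<Longrightarrow> F b \<subseteq> B"
proof
  define C where "C i = ((\<lambda>X. \<Union>a\<in>X. F a) ^^ i) A" for i :: nat
  have C_Suc: "C (Suc i) = (\<Union>a\<in>C i. F a)" for i by (simp add: C_def)
  have CM: "C i \<subseteq> M" for i
  proof (induction i)
    case 0 show ?case using A by (simp add: C_def)
  next
    case (Suc i) then show ?case using F(2) unfolding C_Suc by blast
  qed
  have small: "|C i| <o |UNIV :: 'k set|" for i
  proof (induction i)
    case 0 show ?case using A by (simp add: C_def)
  next
    case (Suc i)
    then show ?case unfolding C_Suc
      by (rule small_UNION) (use F(1) CM in blast)
  qed
  show "A \<subseteq> (\<Union>i. C i)" using C_def[of 0] by fastforce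
  show "(\<Union>i. C i) \<subseteq> M" using CM by blast
  show "|\<Union>i. C i| <o |UNIV :: 'k set|" by (rule small_UNION[OF uncountable_UNIV small])
  show "F b \<subseteq> (\<Union>i. C i)" if "b \<in> (\<Union>i. C i)" for b using that C_Suc by blast
qed

text \<open>
  A strongly linear map that induces, by taking dominant monomials, a strictly increasing map from
  \<open>N\<close> onto \<open>M\<close> maps the series over \<open>N\<close> onto those over \<open>M\<close>.  The preimage of \<open>s\<close> is the longest
  series \<open>p\<close> such that \<open>s - L p\<close> is dominated by the image of each monomial of \<open>p\<close>: of two such
  series, one is an initial part of the other.  That a longest one exists as a series, i.e. that its
  support is small, is where strong linearity enters: all monomials of \<open>p\<close> can be taken in a small set,
  obtained by closing the support of \<open>s\<close> under the passage from \<open>m\<close> to the support of the image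
  of the monomial of \<open>N\<close> that corresponds to \<open>m\<close>.
\<close>

lemma strongly_linear_surj:
  fixes L :: "('r::linordered_field, 'n::linordered_ab_group_add, 'k::regular_uncountable) hahn
    \<Rightarrow> ('r, 'n, 'k) hahn"
  assumes L: "strongly_linear L"
    and nz: "\<And>n. n \<in> N \<Longrightarrow> L (mon n) \<noteq> 0"
    and mono: "\<And>k n. k \<in> N \<Longrightarrow> n \<in> N \<Longrightarrow> k < n \<Longrightarrow> L (mon k) \<prec> L (mon n)"
    and range: "\<And>n. n \<in> N \<Longrightarrow> L (mon n) \<in> series_over M"
    and onto: "\<And>m. m \<in> M \<Longrightarrow> \<exists>n\<in>N. dommon (L (mon n)) = m"
    and s: "s \<in> series_over M"
  obtains p where "p \<in> series_over N" "L p = s"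
proof -
  obtain \<nu> where \<nu>: "\<And>m. m \<in> M \<Longrightarrow> \<nu> m \<in> N \<and> dommon (L (mon (\<nu> m))) = m"
    using onto by metis
  obtain B where B: "supp s \<subseteq> B" "B \<subseteq> M" "|B| <o |UNIV :: 'k set|"
      and B_closed: "\<And>m. m \<in> B \<Longrightarrow> supp (L (mon (\<nu> m))) \<subseteq> B"
  proof (rule small_closure[of "supp s" M "\<lambda>m. supp (L (mon (\<nu> m)))", where 'k = 'k])
    show "|supp s| <o |UNIV :: 'k set|" by (rule small_supp)
    show "supp s \<subseteq> M" using s by (simp add: series_over_def)
    show "|supp (L (mon (\<nu> a)))| <o |UNIV :: 'k set|" for a by (rule small_supp)
    show "supp (L (mon (\<nu> a))) \<subseteq> M" if "a \<in> M" for a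
      using range \<nu>[OF that] by (auto simp: series_over_def)
  qed blast
  define N' where "N' = \<nu> ` B"
  have N': "N' \<subseteq> N" using \<nu> B(2) by (auto simp: N'_def)
  have small_N': "|N'| <o |UNIV :: 'k set|"
    unfolding N'_def by (rule ordLeq_ordLess_trans[OF card_of_image B(3)])
  have L_dommon: "L p \<noteq> 0" "dommon (L p) = dommon (L (mon (dommon p)))"
    if "supp p \<subseteq> N" "p \<noteq> 0" for p
    using dommon_strongly_linear[OF L that(2)] nz mono that dommon_in_supp[OF that(2)] by blast+
  have L_dominated: "L p \<prec> L (mon n)" if "supp p \<subseteq> N" "n \<in> N" "p \<prec> mon n" for p n
  proof (cases "p = 0")
    case True then show ?thesis using nz that by (simp add: strongly_linear_zero[OF L] dominated_iff)
  next
    case False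
    then have "dommon p < n" using that(3) by (simp add: dominated_iff_dommon)
    then have "L (mon (dommon p)) \<prec> L (mon n)"
      using mono dommon_in_supp[OF False] that by blast
    then show ?thesis using L_dommon[OF that(1) False] nz that(1) dommon_in_supp[OF False]
      by (auto simp: dominated_iff_dommon)
  qed
  have le: "r \<prec> L (mon n)" if "r \<prec> L (mon k)" "k \<in> N" "n \<in> N" "k \<le> n" for r k n
    using that mono[of k n] dominated_trans[OF that(1)] by (cases "k = n") simp_all
  define good where "good p \<longleftrightarrow> supp p \<subseteq> N' \<and> (\<forall>n\<in>supp p. s - L p \<prec> L (mon n))" for p
  have good_N: "supp p \<subseteq> N" if "good p" for p using that N' unfolding good_def by blast
  \<comment> \<open>Two approximations have the same coefficients as far as both extend.\<close>
  have agree: "coeff p i = coeff q i"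
    if p: "good p" "k \<in> supp p" and q: "good q" "j \<in> supp q" and i: "k \<le> i" "j \<le> i" for p q k j i
  proof (rule ccontr)
    assume "coeff p i \<noteq> coeff q i"
    then have i_supp: "i \<in> supp (p - q)" by (simp add: supp_def)
    then have ne: "p - q \<noteq> 0" by (auto simp: supp_def)
    let ?d = "dommon (p - q)"
    have sub: "supp (p - q) \<subseteq> N"
      using good_N[OF p(1)] good_N[OF q(1)] supp_diff by blast
    have d: "?d \<in> N" "k \<le> ?d" "j \<le> ?d"
      using dommon_in_supp[OF ne] sub le_dommon[OF i_supp] i by auto
    have "s - L p \<prec> L (mon ?d)" "s - L q \<prec> L (mon ?d)"
      using le[of _ k ?d] le[of _ j ?d] p q d good_N unfolding good_def by blast+
    then have "(s - L q) - (s - L p) \<prec> L (mon ?d)" by (rule dominated_diff[rotated])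
    then have "L (p - q) \<prec> L (mon ?d)" by (simp add: strongly_linear_diff[OF L])
    then show False using L_dommon[OF sub ne] by (simp add: dominated_iff_dommon)
  qed
  \<comment> \<open>The coefficients of the union of all approximations.\<close>
  define c where "c i = (if \<exists>p. good p \<and> i \<in> supp p
      then coeff (SOME p. good p \<and> i \<in> supp p) i else 0)" for i
  have c_agree: "c i = coeff p i" if "good p" "k \<in> supp p" "k \<le> i" for p k i
  proof (cases "\<exists>q. good q \<and> i \<in> supp q")
    case True
    define q where "q = (SOME q. good q \<and> i \<in> supp q)"
    have "good q \<and> i \<in> supp q" unfolding q_def using True by (rule someI_ex)
    then have "coeff p i = coeff q i" using agree[OF that(1,2) _ _ that(3) order_refl] by blast
    then show ?thesis using True by (simp add: c_def q_def)
  next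
    case False
    then show ?thesis using that(1) by (auto simp: c_def supp_def)
  qed
  have c_supp: "\<exists>p. good p \<and> i \<in> supp p" if "c i \<noteq> 0" for i
    using that by (auto simp: c_def split: if_splits)
  have "wfp_on {i. c i \<noteq> 0} (>)"
    unfolding wfp_on_greater_iff
  proof (intro allI impI)
    fix C assume C: "C \<subseteq> {i. c i \<noteq> 0}" "C \<noteq> {}"
    then obtain b where b: "b \<in> C" by blast
    then obtain p where p: "good p" "b \<in> supp p" using C(1) c_supp by blast
    have sub: "{i\<in>C. b \<le> i} \<subseteq> supp p"
      using C(1) c_agree[OF p] by (force simp: supp_def)
    have "{i\<in>C. b \<le> i} \<noteq> {}" using b by blast
    then have "\<exists>m\<in>{i\<in>C. b \<le> i}. \<forall>i\<in>{i\<in>C. b \<le> i}. i \<le> m"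
      using wfp_on_supp[of p] sub unfolding wfp_on_greater_iff by (elim allE impE)
    then obtain m where m: "m \<in> {i\<in>C. b \<le> i}" "\<forall>i\<in>{i\<in>C. b \<le> i}. i \<le> m" by blast
    have "i \<le> m" if "i \<in> C" for i using m that by (cases "b \<le> i") auto
    then show "\<exists>m\<in>C. \<forall>i\<in>C. i \<le> m" using m(1) by blast
  qed
  moreover have "{i. c i \<noteq> 0} \<subseteq> N'" using c_supp unfolding good_def by blast
  then have "|{i. c i \<noteq> 0}| <o |UNIV :: 'k set|"
    by (rule ordLeq_ordLess_trans[OF card_of_mono1 small_N'])
  moreover define p :: "('r, 'n, 'k) hahn" where "p = Abs_hahn c"
  ultimately have p: "coeff p i = c i" for i by (simp add: Abs_hahn_inverse)
  have supp_p: "supp p \<subseteq> N'" using p \<open>{i. c i \<noteq> 0} \<subseteq> N'\<close> by (simp add: supp_def)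
  have good_p: "good p"
    unfolding good_def
  proof (intro conjI ballI)
    fix k assume k: "k \<in> supp p"
    then obtain q where q: "good q" "k \<in> supp q" using c_supp p by (auto simp: supp_def)
    have "p - q \<prec> mon k" using c_agree[OF q] p by (simp add: dominated_iff)
    moreover have "supp (p - q) \<subseteq> N"
      using supp_p N' good_N[OF q(1)] supp_diff by blast
    ultimately have "L (p - q) \<prec> L (mon k)" using L_dominated supp_p N' k by blast
    moreover have "s - L q \<prec> L (mon k)" using q unfolding good_def by blast
    ultimately have "(s - L q) - L (p - q) \<prec> L (mon k)" by (rule dominated_diff[rotated])
    then show "s - L p \<prec> L (mon k)" by (simp add: strongly_linear_diff[OF L])
  qed (rule supp_p)
  \<comment> \<open>Otherwise one more term could be added to the longest approximation.\<close>
  have "s - L p = 0"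
  proof (rule ccontr)
    assume r: "s - L p \<noteq> 0"
    let ?m = "dommon (s - L p)"
    let ?n = "\<nu> ?m"
    have "supp (L p) \<subseteq> B"
      using supp_strongly_linear[OF L, of p] supp_p B_closed unfolding N'_def by blast
    then have m: "?m \<in> B"
      using dommon_in_supp[OF r] B(1) supp_diff by blast
    then have n: "?n \<in> N'" "?n \<in> N" "dommon (L (mon ?n)) = ?m"
      using \<nu> B(2) by (auto simp: N'_def)
    obtain a where a: "a \<noteq> 0" "s - L p - const a * L (mon ?n) \<prec> L (mon ?n)"
      using same_dommon_scale[OF r nz[OF n(2)]] n(3) by auto
    define q where "q = p + const a * mon ?n"
    have res: "s - L q = s - L p - const a * L (mon ?n)"
      by (simp add: q_def strongly_linear_add[OF L] strongly_linear_scale[OF L])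
    have dom: "L (mon ?n) \<prec> L (mon k)" if "k \<in> supp p" for k
      using good_p that n(3) nz[OF n(2)] r unfolding good_def by (simp add: dominated_iff_dommon)
    then have n_p: "?n \<notin> supp p" by (auto simp: dominated_iff_dommon)
    have supp_q: "supp q \<subseteq> insert ?n (supp p)" by (auto simp: q_def supp_def)
    have "good q"
      unfolding good_def res using supp_q supp_p n(1) a(2) dom dominated_trans[OF a(2) dom] by blast
    moreover have "?n \<in> supp q" using n_p a(1) by (simp add: q_def supp_def)
    ultimately have "c ?n \<noteq> 0" using c_agree[of q ?n ?n] by (simp add: supp_def)
    then show False using n_p p by (simp add: supp_def)
  qed
  moreover have "p \<in> series_over N" using supp_p N' by (simp add: series_over_def)
  ultimately show thesis using that by simp
qed


section \<open>Derivations and logarithms\<close>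

lemma (in transserial_field) log_one_plus_infinitesimal:
  assumes "\<delta> \<prec> 1"
  shows "Log (1 + \<delta>) \<prec> 1"
proof -
  let ?F = "\<lambda>k. const ((-1) ^ (k + 1) / of_nat k) * \<delta> ^ k"
  \<comment> \<open>No term of the logarithmic series has a monomial \<open>\<ge> 1\<close> in its support.\<close>
  have mult: "s * t \<prec> 1" if "s \<prec> 1" "t \<prec> 1" for s t :: "('r, 'n, 'k) hahn"
  proof (cases "s = 0 \<or> t = 0")
    case False
    then show ?thesis using that by (simp add: dominated_iff_dommon dommon_times add_neg_neg)
  qed (auto simp: dominated_iff)
  have power: "\<delta> ^ Suc k \<prec> 1" for k
    by (induction k) (use assms mult in auto)
  have "?F k \<prec> 1" if "k \<in> {0<..}" for k
    using that power[of "k - 1"] by (intro dominated_const_times) simp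
  then have none: "{k \<in> {0<..}. j \<in> supp (?F k)} = {}" if "0 \<le> j" for j
    using that unfolding dominated_one_iff supp_def by blast
  have F: "summable_family ?F {0<..}" "Log (1 + \<delta>) = family_sum ?F {0<..}"
    using log_one_plus[OF assms] by blast+
  have "coeff (Log (1 + \<delta>)) j = 0" if "0 \<le> j" for j
    unfolding F(2) coeff_family_sum[OF F(1)] none[OF that] by simp
  then show ?thesis by (simp add: dominated_one_iff)
qed

lemma (in transserial_field) log_quotient_infinitesimal:
  assumes t: "0 < t" and quot: "t - mon m \<prec> mon m"
  shows "Log t - Log (mon m) \<prec> 1"
proof -
  define \<delta> where "\<delta> = mon (- m) * (t - mon m)"
  have inv: "mon m * mon (- m) = (1 :: ('r, 'n, 'k) hahn)"
    by (simp flip: mon_add mon_zero)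
  have "\<delta> \<prec> 1"
    using quot by (simp add: \<delta>_def dominated_one_iff dominated_iff)
  have "mon m * (1 + \<delta>) = mon m + (mon m * mon (- m)) * (t - mon m)"
    by (simp add: \<delta>_def algebra_simps)
  then have eq: "mon m * (1 + \<delta>) = t" by (simp add: inv)
  then have "0 < 1 + \<delta>" using t by (metis mon_pos zero_less_mult_pos)
  then have "Log t = Log (mon m) + Log (1 + \<delta>)" using log_mult[of "mon m" "1 + \<delta>"] eq by simp
  then show ?thesis using log_one_plus_infinitesimal[OF \<open>\<delta> \<prec> 1\<close>] by simp
qed

lemma (in transserial_derivation) D_const: "D (const c) = 0"
  using D_kernel by blast

lemma (in transserial_derivation) D_neg_infinitesimal:
  assumes "0 < s" "s \<prec> 1"
  shows "D s < 0"
proof -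
  have "- Log s \<in> pos_infinite"
    unfolding pos_infinite_def
  proof safe
    fix r
    have "const (- r) \<in> Log ` const ` {0<..}" using log_const_bij by (auto simp: bij_betw_def)
    then obtain u where u: "0 < u" "Log (const u) = const (- r)" by auto
    have cu: "const u \<noteq> (0 :: ('r, 'n, 'k) hahn)" "dommon (const u :: ('r, 'n, 'k) hahn) = 0"
      using u(1) dommon_eqI[of "const u :: ('r, 'n, 'k) hahn" 0]
      by (auto simp: single.rep_eq dest: arg_cong[of _ _ "\<lambda>s. coeff s 0"])
    then have pos: "0 < (const u :: ('r, 'n, 'k) hahn)"
      using u(1) by (simp add: hahn_pos_iff_dommon single.rep_eq)
    have "s \<prec> const u" using assms(2) cu by (simp add: dominated_iff)
    then have "s < const u" using dominatedD[OF _ pos, of s 1] by (simp add: const_one)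
    then have "Log s < const (- r)"
      using log_strict_mono assms(1) pos u(2) by (metis greaterThan_iff strict_mono_onD)
    moreover have "const (- r) = - (const r :: ('r, 'n, 'k) hahn)"
      by (rule hahn_eqI) (simp add: single.rep_eq)
    ultimately show "const r < - Log s" by simp
  qed
  then have "D (Log s) < 0"
    using D_pos_infinite strongly_linear_minus[OF D_strongly_linear, of "Log s"] by fastforce
  moreover have "D (Log s) * s = D s" using D_log[of s] assms(1) by simp
  ultimately show ?thesis using assms(1) by (metis mult_neg_pos)
qed

lemma (in transserial_derivation) x_pos_infinite: "x \<in> pos_infinite"
proof -
  have ne: "x \<noteq> 0" using x_pos by simp
  then have "dommon x \<noteq> 0" using dommon_in_supp x_no_constant_term by metis
  moreover have "\<not> dommon x < 0"
    using D_neg_infinitesimal[OF x_pos] D_x by (auto simp: dominated_iff_dommon)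
  ultimately show ?thesis using x_pos by (simp add: pos_infinite_iff)
qed

text \<open>The reason is, for \<open>t > 0\<close>, that the series \<open>t - r s\<close> with \<open>r\<close> constant are either all positive
  infinite or all positive infinitesimal, so that their derivatives all have the same sign.\<close>

lemma (in transserial_derivation) D_dominated:
  assumes "s \<prec> t" "dommon t \<noteq> 0"
  shows "D s \<prec> D t"
proof -
  note D_lin = strongly_linear_diff[OF D_strongly_linear] strongly_linear_scale[OF D_strongly_linear]
  have pos: "D s \<prec> D t" if t: "0 < t" "s \<prec> t" "dommon t \<noteq> 0" for t
  proof -
    have p: "0 < t - const r * s" for r using dominatedD t by blast
    have d: "dommon (t - const r * s) = dommon t" for r
      by (rule dommon_cong(2)[of _ 1])
        (use dominated_const_times[OF t(2), of "- r"] in \<open>simp_all add: const_one dominated_iff\<close>)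
    show ?thesis
    proof (cases "0 < dommon t")
      case True
      then have "0 < D (t - const r * s)" for r using p d by (simp add: D_pos_infinite pos_infinite_iff)
      then show ?thesis by (intro dominatedI) (simp add: D_lin)
    next
      case False
      then have "D (t - const r * s) < 0" for r
        using p[of r] d[of r] t(3)
        by (intro D_neg_infinitesimal) (auto simp: dominated_iff_dommon)
      then have "D t < const (- r) * D s" for r using D_lin by (metis diff_less_0_iff_less)
      moreover have "const (- r) * D s = - (const r * D s)" for r by (rule hahn_eqI) simp
      ultimately have "D s \<prec> - D t" by (intro dominatedI) (simp add: less_minus_iff)
      then show ?thesis by simp
    qed
  qed
  show ?thesis
  proof (cases "0 < t")
    case True then show ?thesis using pos assms by blast
  next
    case False
    then have "0 < - t" using assms(1) by (auto simp: dominated_iff)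
    then have "D s \<prec> D (- t)" using pos[of "- t"] assms by simp
    then show ?thesis by (simp add: strongly_linear_minus[OF D_strongly_linear])
  qed
qed


section \<open>The difference operator of an infinitesimal shift\<close>

text \<open>By linearity, the difference \<open>f \<odot> g - f\<close> is thus an order-preserving function of the derivative
  of \<open>f\<close>.\<close>

lemma (in transserial_composition) difference_pos:
  assumes "g \<in> pos_infinite" "x < g" "0 < D f"
  shows "0 < f \<odot> g - f"
proof -
  have "f \<notin> range const" using D_const assms(3) by auto
  then have "f \<odot> x < f \<odot> g"
    using compose_increasing[of f] assms x_pos_infinite by (auto dest: strict_mono_onD)
  then show ?thesis by (simp add: compose_x)
qed

lemma (in transserial_composition) zero_compose: "s \<in> pos_infinite \<Longrightarrow> 0 \<odot> s = 0"
  using strongly_linear_zero[OF compose_strongly_linear] .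

lemma (in transserial_composition) const_compose:
  assumes "s \<in> pos_infinite"
  shows "const c \<odot> s = const c"
proof -
  have "(const c * 1) \<odot> s = const c * (1 \<odot> s)"
    using strongly_linear_scale[OF compose_strongly_linear[OF assms]] .
  then show ?thesis by (simp add: compose_one[OF assms])
qed

lemma (in transserial_composition) mon_compose_pos:
  assumes "s \<in> pos_infinite"
  shows "0 < mon m \<odot> s"
proof -
  have "(mon m \<odot> s) * (mon (- m) \<odot> s) = (mon m * mon (- m)) \<odot> s"
    by (simp add: compose_mult[OF assms])
  also have "mon m * mon (- m) = (1 :: ('r, 'n, 'k) hahn)" by (simp flip: mon_add mon_zero)
  finally have "mon m \<odot> s \<noteq> 0" by (auto simp: compose_one[OF assms])
  moreover have "0 \<odot> s \<le> mon m \<odot> s"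
    using compose_mono[OF assms] mon_pos[of m] by (simp add: less_imp_le)
  ultimately show ?thesis by (simp add: zero_compose[OF assms])
qed

text \<open>A field of series over a group \<open>M\<close> of monomials that is closed under composition and
  compositional inversion and on which the derivation is surjective, and a positive infinitesimal \<open>\<epsilon>\<close> in it by which \<open>x\<close>
  is shifted.\<close>

locale infinitesimal_shift = transserial_composition Log D x cmp
  for Log :: "('r::linordered_field, 'n::linordered_ab_group_add, 'k::regular_uncountable) hahn
    \<Rightarrow> ('r, 'n, 'k) hahn"
    and D x and cmp (infixl "\<odot>" 75) +
  fixes M :: "'n set" and \<epsilon> :: "('r, 'n, 'k) hahn"
  assumes M_subgroup: "monomial_subgroup M"
    and D_surj_M: "D ` series_over M = series_over M"
    and compose_closed: "f \<in> series_over M \<Longrightarrow> s \<in> series_over M \<inter> pos_infinite \<Longrightarrow>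
      f \<odot> s \<in> series_over M"
    and group_M: "group \<lparr>carrier = series_over M \<inter> pos_infinite, mult = (\<odot>), one = x\<rparr>"
    and x_in_M: "x \<in> series_over M"
    and shift_in_M: "\<epsilon> \<in> series_over M"
    and shift_pos: "0 < \<epsilon>"
    and shift_small: "\<epsilon> \<prec> 1"
begin

text \<open>The operator \<open>\<Delta>\<close>, which takes \<open>f\<close> to its increment under the shift.\<close>

definition difference :: "('r, 'n, 'k) hahn \<Rightarrow> ('r, 'n, 'k) hahn"
  where "difference f = f \<odot> (x + \<epsilon>) - f"

lemma shift_neq_0: "\<epsilon> \<noteq> 0"
  using shift_pos by simp

lemma shift_dominated_x: "\<epsilon> \<prec> x"
  using dominated_trans[OF shift_small, of x] x_pos_infinite
  by (auto simp: pos_infinite_iff dominated_iff_dommon)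

lemma shifted_pos_infinite: "x + \<epsilon> \<in> pos_infinite"
proof -
  have "dommon (x + \<epsilon>) = dommon x"
    by (rule dommon_cong(2)[of _ 1]) (simp_all add: const_one shift_dominated_x)
  then show ?thesis using x_pos_infinite shift_pos by (simp add: pos_infinite_iff add_pos_pos)
qed

lemma shifted_in_M: "x + \<epsilon> \<in> series_over M \<inter> pos_infinite"
  using shifted_pos_infinite x_in_M shift_in_M supp_add by (fastforce simp: series_over_def)

lemma strongly_linear_difference: "strongly_linear difference"
  unfolding difference_def
  by (rule strongly_linear_sub_identity[OF compose_strongly_linear[OF shifted_pos_infinite]])

lemma difference_const: "difference (const c) = 0"
  by (simp add: difference_def const_compose shifted_pos_infinite)

lemma difference_x: "difference x = \<epsilon>"
  by (simp add: difference_def x_compose shifted_pos_infinite)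

lemma difference_D_pos: "0 < D f \<Longrightarrow> 0 < difference f"
  using difference_pos[OF shifted_pos_infinite] shift_pos by (simp add: difference_def)

lemma difference_dominated_D:
  assumes "D s \<prec> D t"
  shows "difference s \<prec> difference t"
proof -
  note D_lin = strongly_linear_diff[OF D_strongly_linear] strongly_linear_scale[OF D_strongly_linear]
  note diff_lin = strongly_linear_diff[OF strongly_linear_difference]
    strongly_linear_scale[OF strongly_linear_difference]
  have pos: "difference s \<prec> difference t" if "D s \<prec> D t" "0 < D t" for t
  proof (rule dominatedI)
    fix r
    have "0 < D (t - const r * s)" using dominatedD[OF that] by (simp add: D_lin)
    from difference_D_pos[OF this] show "const r * difference s < difference t" by (simp add: diff_lin)
  qed
  show ?thesis
  proof (cases "0 < D t")
    case True then show ?thesis using pos assms by blast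
  next
    case False
    then have "0 < D (- t)"
      using assms by (auto simp: dominated_iff strongly_linear_minus[OF D_strongly_linear])
    then have "difference s \<prec> difference (- t)"
      using pos[of "- t"] assms by (simp add: strongly_linear_minus[OF D_strongly_linear])
    then show ?thesis by (simp add: strongly_linear_minus[OF strongly_linear_difference])
  qed
qed

lemma difference_dominated: "s \<prec> t \<Longrightarrow> dommon t \<noteq> 0 \<Longrightarrow> difference s \<prec> difference t"
  by (rule difference_dominated_D[OF D_dominated])

lemma difference_mon_neq_0: "n \<noteq> 0 \<Longrightarrow> difference (mon n) \<noteq> 0"
  using difference_dominated[of 0 "mon n"] by (auto simp: dominated_iff)

lemma D_mon_neq_0: "n \<noteq> 0 \<Longrightarrow> D (mon n) \<noteq> 0"
  using D_dominated[of 0 "mon n"] by (auto simp: dominated_iff)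

text \<open>If the first-order term of the Taylor expansion at \<open>x\<close> is smaller than the monomial itself, it
  is the dominant part of the difference.\<close>

lemma difference_Taylor:
  assumes n: "n \<noteq> 0" and small: "D (mon n) * \<epsilon> \<prec> mon n"
  shows "dommon (difference (mon n)) = dommon (D (mon n)) + dommon \<epsilon>"
proof -
  let ?f = "mon n :: ('r, 'n, 'k) hahn"
  define u where "u k = (D ^^ k) ?f * \<epsilon> ^ k" for k
  define t where "t k = const (1 / fact k) * (D ^^ k) ?f * \<epsilon> ^ k" for k :: nat
  have t_u: "coeff (t k) j = coeff (u k) j / fact k" for k j
    by (simp add: t_def u_def mult.assoc)
  have tay: "summable_family t UNIV" "?f \<odot> (x + \<epsilon>) = family_sum t UNIV"
      "\<And>k. u k \<noteq> 0 \<Longrightarrow> u (k + 1) \<prec> u k"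
    using taylor[OF x_pos_infinite shift_dominated_x, of ?f] small
    unfolding compose_x supp_mon t_def u_def by auto
  have u1: "u 1 = D ?f * \<epsilon>" by (simp add: u_def)
  have u1_ne: "u 1 \<noteq> 0" using D_mon_neq_0[OF n] shift_neq_0 unfolding u1 by simp
  have step: "u (Suc k) = 0" if "u k = 0" for k
    using that shift_neq_0 by (auto simp: u_def strongly_linear_zero[OF D_strongly_linear])
  have higher: "u (Suc (Suc k)) \<prec> u 1" for k
  proof (induction k)
    case 0 show ?case using tay(3)[of 1] u1_ne by simp
  next
    case (Suc k)
    show ?case
    proof (cases "u (Suc (Suc k)) = 0")
      case True then show ?thesis using step u1_ne by (simp add: dominated_iff)
    next
      case False
      then have "u (Suc (Suc (Suc k))) \<prec> u (Suc (Suc k))" using tay(3) by fastforce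
      then show ?thesis using Suc.IH by (rule dominated_trans)
    qed
  qed
  have "coeff (difference ?f) j = coeff (u 1) j" if j: "dommon (u 1) \<le> j" for j
  proof -
    have "coeff (t k) j = 0" if "k \<notin> {0, 1}" for k
    proof -
      from that have "k = Suc (Suc (k - 2))" by auto
      then have "u k \<prec> u 1" using higher by metis
      then show ?thesis using j by (simp add: t_u dominated_iff)
    qed
    then have "{k. k \<in> UNIV \<and> j \<in> supp (t k)} \<subseteq> {0, 1}" by (auto simp: supp_def)
    then have "coeff (?f \<odot> (x + \<epsilon>)) j = (\<Sum>k\<in>{0, 1}. coeff (t k) j)"
      unfolding tay(2) coeff_family_sum[OF tay(1)]
      by (intro sum.mono_neutral_left) (auto simp: supp_def)
    also have "\<dots> = coeff ?f j + coeff (u 1) j" by (simp add: t_u) (simp add: u_def)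
    finally show ?thesis by (simp add: difference_def)
  qed
  then have "difference ?f - const 1 * u 1 \<prec> u 1" using u1_ne by (simp add: dominated_iff)
  then have "dommon (difference ?f) = dommon (u 1)" by (rule dommon_cong(2)) simp
  then show ?thesis
    unfolding u1 using dommon_times[OF D_mon_neq_0[OF n] shift_neq_0] by simp
qed

lemma mon_in_M: "m \<in> M \<Longrightarrow> mon m \<in> series_over M"
  by (simp add: series_over_def supp_mon)

lemma shift_dommon: "dommon \<epsilon> \<in> M" "dommon \<epsilon> < 0"
  using shift_in_M dommon_in_supp[OF shift_neq_0] shift_small shift_neq_0
  by (auto simp: series_over_def dominated_iff_dommon)

lemma mon_antiderivative:
  assumes "m \<in> M"
  obtains n where "n \<in> M - {0}" "dommon (D (mon n)) = m"
proof -
  have "mon m \<in> D ` series_over M" unfolding D_surj_M by (rule mon_in_M[OF assms])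
  then obtain h where h: "h \<in> series_over M" "D h = mon m" by auto
  show thesis
    using dommon_value_monomial[OF D_strongly_linear D_dominated D_const h(1)] that h(2)
    by (metis dommon_mon mon_neq_zero)
qed

lemma difference_dommon_zero:
  obtains n where "n \<in> M - {0}" "dommon (D (mon n)) = - dommon \<epsilon>" "dommon (difference (mon n)) = 0"
proof -
  have "- dommon \<epsilon> \<in> M" using shift_dommon M_subgroup by (simp add: monomial_subgroup_def)
  then obtain n where n: "n \<in> M - {0}" "dommon (D (mon n)) = - dommon \<epsilon>"
    by (rule mon_antiderivative)
  have "0 < n"
  proof (rule ccontr)
    assume "\<not> 0 < n"
    then have "mon n \<prec> x" using n(1) x_pos_infinite by (auto simp: dominated_iff_dommon pos_infinite_iff)
    then have "D (mon n) \<prec> 1" using D_dominated x_pos_infinite D_x by (metis pos_infinite_iff less_irrefl)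
    then show False using n D_mon_neq_0[of n] shift_dommon by (auto simp: dominated_iff_dommon)
  qed
  then have "D (mon n) * \<epsilon> \<prec> mon n"
    using n D_mon_neq_0[of n] shift_neq_0 by (simp add: dominated_iff_dommon dommon_times)
  then show thesis using that n difference_Taylor[of n] by simp
qed

text \<open>If the monomial \<open>m \<noteq> 1\<close> is asymptotic to its shift, its logarithmic derivative is smaller than
  \<open>\<epsilon>\<^sup>-\<^sup>1\<close>.  Otherwise the difference of its logarithm would be at least of the size of the difference
  of a monomial with derivative of the size of \<open>\<epsilon>\<^sup>-\<^sup>1\<close>, which is not infinitesimal.\<close>

lemma small_logarithmic_derivative:
  assumes m: "m \<noteq> 0" and same: "mon m \<odot> (x + \<epsilon>) - mon m \<prec> mon m"
  shows "dommon (D (mon m)) < m - dommon \<epsilon>"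
proof (rule ccontr)
  assume "\<not> ?thesis"
  then have ge: "m - dommon \<epsilon> \<le> dommon (D (mon m))" by simp
  let ?l = "Log (mon m)"
  have "D ?l * mon m = D (mon m)" using D_log[of "mon m"] unfolding abs_of_pos[OF mon_pos] by simp
  then have eq: "mon m * D ?l = D (mon m)" by (simp add: mult.commute)
  then have Dl: "D ?l \<noteq> 0" using D_mon_neq_0[OF m] by auto
  have "dommon (D (mon m)) = m + dommon (D ?l)" using dommon_mon_times[OF Dl, of m] unfolding eq .
  then have "m + - dommon \<epsilon> \<le> m + dommon (D ?l)" using ge by simp
  then have dl: "- dommon \<epsilon> \<le> dommon (D ?l)" by (rule add_le_imp_le_left)
  have "difference ?l = Log (mon m \<odot> (x + \<epsilon>)) - ?l"
    by (simp add: difference_def compose_log[OF shifted_pos_infinite])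
  then have small: "difference ?l \<prec> 1"
    using log_quotient_infinitesimal[OF mon_compose_pos[OF shifted_pos_infinite] same] by simp
  obtain n where n: "n \<in> M - {0}" "dommon (D (mon n)) = - dommon \<epsilon>" "dommon (difference (mon n)) = 0"
    by (rule difference_dommon_zero)
  have Dn: "D (mon n) \<noteq> 0" using n D_mon_neq_0 by blast
  show False
  proof (cases "dommon (D ?l) = - dommon \<epsilon>")
    case False
    then have "- dommon \<epsilon> < dommon (D ?l)" using dl by simp
    then have "D (mon n) \<prec> D ?l" using n(2) Dl by (simp add: dominated_iff_dommon)
    then have "difference (mon n) \<prec> difference ?l" by (rule difference_dominated_D)
    then have "difference (mon n) \<prec> 1" using small by (rule dominated_trans)
    then show False using n difference_mon_neq_0[of n] by (simp add: dominated_iff_dommon)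
  next
    case True
    then have "dommon (D ?l) = dommon (D (mon n))" using n(2) by simp
    then obtain c where c: "c \<noteq> 0" "D ?l - const c * D (mon n) \<prec> D (mon n)"
      by (rule same_dommon_scale[OF Dl Dn])
    then have "D (?l - const c * mon n) \<prec> D (mon n)"
      by (simp add: strongly_linear_diff[OF D_strongly_linear] strongly_linear_scale[OF D_strongly_linear])
    then have "difference (?l - const c * mon n) \<prec> difference (mon n)"
      by (rule difference_dominated_D)
    then have "difference ?l - const c * difference (mon n) \<prec> difference (mon n)"
      by (simp add: strongly_linear_diff[OF strongly_linear_difference]
          strongly_linear_scale[OF strongly_linear_difference])
    from dommon_cong[OF this c(1)] have "difference ?l \<noteq> 0" "dommon (difference ?l) = 0"
      using n(3) by simp_all
    then show False using small by (simp add: dominated_iff_dommon)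
  qed
qed

lemma difference_onto_monomials:
  assumes m: "m \<in> M"
  shows "\<exists>n\<in>M - {0}. dommon (difference (mon n)) = m"
proof -
  have attained: "\<exists>n\<in>M - {0}. dommon (difference (mon n)) = m"
    if "h \<in> series_over M" "difference h \<noteq> 0" "dommon (difference h) = m" for h
    using dommon_value_monomial[OF strongly_linear_difference difference_dominated difference_const that(1,2)]
      that(3) by metis
  let ?t = "mon m \<odot> (x + \<epsilon>)"
  have t: "0 < ?t" by (rule mon_compose_pos[OF shifted_pos_infinite])
  \<comment> \<open>The case \<open>c = 0\<close> of \<open>scaled\<close> is the one where the shift of \<open>m\<close> is dominated by \<open>m\<close>.\<close>
  consider (one) "m = 0" | (grow) "mon m \<prec> ?t"
    | (scaled) c where "c \<noteq> 1" "?t - const c * mon m \<prec> mon m"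
    | (same) "m \<noteq> 0" "?t - mon m \<prec> mon m"
  proof (cases "dommon ?t" m rule: linorder_cases)
    case less
    then have "?t - const 0 * mon m \<prec> mon m" by (simp add: dominated_iff_dommon)
    then show thesis using scaled[of 0] by simp
  next
    case equal
    then obtain c where "?t - const c * mon m \<prec> mon m"
      using same_dommon_scale[of ?t "mon m"] t by (metis dommon_mon less_irrefl mon_neq_zero)
    then show thesis using one scaled[of c] same by (cases "c = 1") (auto simp: const_one)
  next
    case greater
    then show thesis using grow t by (auto simp: dominated_iff_dommon)
  qed
  then show ?thesis
  proof cases
    case one
    then show ?thesis using difference_dommon_zero by metis
  next
    case grow
    interpret G: group "\<lparr>carrier = series_over M \<inter> pos_infinite, mult = (\<odot>), one = x\<rparr>"
      by (rule group_M)
    \<comment> \<open>Here the difference of \<open>m \<odot> g\<close>, for \<open>g\<close> inverse to the shift, is \<open>m - m \<odot> g\<close>.\<close>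
    obtain g where g: "g \<in> series_over M \<inter> pos_infinite" "g \<odot> (x + \<epsilon>) = x"
      using G.l_inv_ex[of "x + \<epsilon>"] shifted_in_M by auto
    then have g': "(x + \<epsilon>) \<odot> g = x" using G.inv_comm[of g "x + \<epsilon>"] shifted_in_M by simp
    have gp: "g \<in> pos_infinite" using g by blast
    let ?h = "mon m \<odot> g"
    have "?h \<odot> (x + \<epsilon>) = mon m"
      using compose_assoc[OF gp shifted_pos_infinite, of "mon m"] g(2) by (simp add: compose_x)
    then have diff: "difference ?h = mon m - ?h" by (simp add: difference_def)
    have "?h \<prec> mon m"
    proof (rule dominatedI)
      fix r
      have "const (r + 1) * mon m \<le> ?t" using dominatedD[OF grow t, of "r + 1"] by simp
      then have "(const (r + 1) * mon m) \<odot> g \<le> ?t \<odot> g" by (rule compose_mono[OF gp])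
      also have "?t \<odot> g = mon m"
        using compose_assoc[OF shifted_pos_infinite gp, of "mon m"] g' by (simp add: compose_x)
      finally have "const (r + 1) * ?h \<le> mon m"
        by (simp add: strongly_linear_scale[OF compose_strongly_linear[OF gp]])
      moreover have "const (r + 1) * ?h = const r * ?h + ?h"
        by (rule hahn_eqI) (simp add: distrib_right)
      ultimately show "const r * ?h < mon m" using mon_compose_pos[OF gp, of m] by (simp add: less_le_trans)
    qed
    then have "difference ?h - const 1 * mon m \<prec> mon m"
      unfolding diff by (simp add: dominated_iff)
    then show ?thesis
      using attained[of ?h] dommon_cong[of "difference ?h" 1 "mon m"] compose_closed[OF mon_in_M[OF m] g(1)]
      by simp
  next
    case (scaled c)
    have "difference (mon m) - const (c - 1) * mon m = ?t - const c * mon m"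
      by (rule hahn_eqI) (simp add: difference_def left_diff_distrib)
    then show ?thesis
      using attained[OF mon_in_M[OF m]] dommon_cong[of "difference (mon m)" "c - 1" "mon m"] scaled by simp
  next
    case same
    have "m + - dommon \<epsilon> \<in> M" using m shift_dommon M_subgroup unfolding monomial_subgroup_def by blast
    then obtain n where n: "n \<in> M - {0}" "dommon (D (mon n)) = m - dommon \<epsilon>"
      using mon_antiderivative[of "m - dommon \<epsilon>"] by auto
    have flat: "dommon (D (mon m)) < m - dommon \<epsilon>" by (rule small_logarithmic_derivative[OF same])
    have "m < n"
    proof (rule ccontr)
      assume "\<not> m < n"
      then have "n = m \<or> mon n \<prec> mon m" by (auto simp: dominated_iff_dommon)
      then have "n = m \<or> D (mon n) \<prec> D (mon m)" using D_dominated[of "mon n" "mon m"] same(1) by auto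
      then show False using flat n D_mon_neq_0[of n] by (auto simp: dominated_iff_dommon)
    qed
    then have "D (mon n) * \<epsilon> \<prec> mon n"
      using n D_mon_neq_0[of n] shift_neq_0 by (simp add: dominated_iff_dommon dommon_times)
    then show ?thesis using n difference_Taylor[of n] by auto
  qed
qed

lemma difference_closed: "f \<in> series_over M \<Longrightarrow> difference f \<in> series_over M"
  using compose_closed[OF _ shifted_in_M] supp_diff
  unfolding difference_def series_over_def by blast

lemma Abel_equation_shift: "\<exists>W\<in>series_over M \<inter> pos_infinite. W \<odot> (x + \<epsilon>) = W + 1"
proof -
  have "1 \<in> series_over M" using mon_in_M[of 0] M_subgroup by (simp add: mon_zero monomial_subgroup_def)
  then obtain W where W: "W \<in> series_over (M - {0})" "difference W = 1"
  proof (rule strongly_linear_surj[OF strongly_linear_difference, rotated -2])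
    show "difference (mon k) \<prec> difference (mon n)" if "k \<in> M - {0}" "n \<in> M - {0}" "k < n" for k n
      by (rule difference_dominated) (use that in \<open>auto simp: dominated_iff_dommon\<close>)
  qed (use difference_mon_neq_0 difference_closed mon_in_M difference_onto_monomials in blast)+
  have W_M: "W \<in> series_over M" using W(1) by (auto simp: series_over_def)
  have "W \<noteq> 0" using W(2) strongly_linear_zero[OF strongly_linear_difference] by auto
  then have "dommon W \<noteq> 0" using dommon_in_supp W(1) by (auto simp: series_over_def)
  \<comment> \<open>If \<open>W\<close> were infinitesimal, then \<open>1 = \<Delta> W \<prec> \<Delta> x = \<epsilon>\<close>.\<close>
  moreover have "\<not> dommon W < 0"
  proof
    assume "dommon W < 0"
    then have "W \<prec> x" using x_pos_infinite by (auto simp: dominated_iff_dommon pos_infinite_iff)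
    then have "difference W \<prec> difference x"
      using x_pos_infinite by (intro difference_dominated) (auto simp: pos_infinite_iff)
    then have "1 \<prec> \<epsilon>" by (simp add: W(2) difference_x)
    then show False using shift_small by (auto simp: dominated_iff_dommon)
  qed
  ultimately have d: "0 < dommon W" by simp
  have "0 < W"
  proof (rule ccontr)
    assume "\<not> 0 < W"
    then have "- W \<in> pos_infinite" using d \<open>W \<noteq> 0\<close> by (simp add: pos_infinite_iff)
    then have "0 < difference (- W)" by (intro difference_D_pos D_pos_infinite)
    then show False by (simp add: strongly_linear_minus[OF strongly_linear_difference] W(2))
  qed
  then have "W \<in> pos_infinite" using d by (simp add: pos_infinite_iff)
  moreover have "W \<odot> (x + \<epsilon>) = W + 1" using W(2) by (simp add: difference_def algebra_simps)
  ultimately show ?thesis using W_M by blast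
qed

end

section \<open>The equation for arbitrary series\<close>

theorem theorem4p6:
  fixes Log :: "('r::linordered_field, 'n::linordered_ab_group_add, 'k::regular_uncountable) hahn
      \<Rightarrow> ('r, 'n, 'k) hahn"
    and D :: "('r, 'n, 'k) hahn \<Rightarrow> ('r, 'n, 'k) hahn"
    and x :: "('r, 'n, 'k) hahn"
    and cmp :: "('r, 'n, 'k) hahn \<Rightarrow> ('r, 'n, 'k) hahn \<Rightarrow> ('r, 'n, 'k) hahn"
    and M :: "'n set"
  assumes "transserial_composition Log D x cmp"
    and "models_real_exp_theory (exp_const Log)"
    and "monomial_subgroup M" and "x \<in> mon ` M"
    and "D ` series_over M = series_over M"
    and "\<And>g s. g \<in> series_over M \<Longrightarrow> s \<in> series_over M \<inter> pos_infinite \<Longrightarrow>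
      cmp g s \<in> series_over M"
    and "group \<lparr>carrier = series_over M \<inter> pos_infinite, mult = cmp, one = x\<rparr>"
    and "\<exists>U. steep_conjugate Log D x cmp M U"
  shows "\<forall>f \<in> series_over M \<inter> pos_infinite. x < f \<longrightarrow>
    (\<exists>V \<in> series_over M \<inter> pos_infinite. cmp V f = V + 1)"
proof (intro ballI impI)
  fix f assume f: "f \<in> series_over M \<inter> pos_infinite" "x < f"
  interpret transserial_composition Log D x cmp by (rule assms(1))
  interpret G: group "\<lparr>carrier = series_over M \<inter> pos_infinite, mult = cmp, one = x\<rparr>"
    by (rule assms(7))
  obtain U where "steep_conjugate Log D x cmp M U" using assms(8) by blast
  then obtain V \<epsilon> where V: "V \<in> series_over M \<inter> pos_infinite" "cmp V f = cmp (x + \<epsilon>) V"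
      and \<epsilon>: "\<epsilon> \<in> series_over U" "\<epsilon> \<prec> 1" "0 < \<epsilon>" and "U \<subseteq> M"
    using f unfolding steep_conjugate_def steep_subfield_def by blast
  interpret infinitesimal_shift Log D x cmp M \<epsilon>
  proof unfold_locales
    show "x \<in> series_over M" using assms(4) by (auto simp: series_over_def supp_mon)
    show "\<epsilon> \<in> series_over M" using \<epsilon>(1) \<open>U \<subseteq> M\<close> by (auto simp: series_over_def)
  qed (use assms(3,5,6,7) \<epsilon> in blast)+
  obtain W where W: "W \<in> series_over M \<inter> pos_infinite" "cmp W (x + \<epsilon>) = W + 1"
    using Abel_equation_shift by blast
  have inf: "V \<in> pos_infinite" "f \<in> pos_infinite" "x + \<epsilon> \<in> pos_infinite"
    using V f shifted_pos_infinite by blast+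
  have "cmp (cmp W V) f = cmp W (cmp (x + \<epsilon>) V)"
    using compose_assoc[OF inf(1,2)] V(2) by metis
  also have "\<dots> = cmp (W + 1) V" using compose_assoc[OF inf(3,1)] W(2) by metis
  also have "\<dots> = cmp W V + 1"
    by (simp add: strongly_linear_add[OF compose_strongly_linear[OF inf(1)]] compose_one[OF inf(1)])
  finally have "cmp (cmp W V) f = cmp W V + 1" .
  moreover have "cmp W V \<in> series_over M \<inter> pos_infinite" using G.m_closed[of W V] W(1) V(1) by simp
  ultimately show "\<exists>V \<in> series_over M \<inter> pos_infinite. cmp V f = V + 1" by blast
qed

end
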